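(* Let $\alpha,\beta,\gamma,b,c,z,s\in\mathbb{C}$ with $\mathrm{Re}(\alpha)>0$, $\mathrm{Re}(c)>\mathrm{Re}(b)>0$ and $\mathrm{Re}(s)>0$. Then the Mellin transform in $p$ of the ML-generalized confluent hypergeometric function is $$\mathfrak{M}\left[{}^{ML}\Phi_{p}(b;c;z):s\right]=\int_0^\infty p^{s-1}\;{}^{ML}\Phi_{p}(b;c;z)\,dp=\frac{{}^{ML}\Gamma(s)\,B(b+s,c+s-b)}{B(b,c-b)}\;\Phi(b+s;c+2s;z).$$
   Context: The three-parameter Mittag-Leffler function is $E_{\alpha,\beta}^{\gamma}(z)=\sum_{n=0}^{\infty}\frac{(\gamma)_n}{\Gamma(\alpha n+\beta)}\frac{z^n}{n!}$ for $\alpha,\beta,\gamma\in\mathbb{C}$, $\mathrm{Re}(\alpha)>0$, where $(\gamma)_n=\gamma(\gamma+1)\cdots(\gamma+n-1)$, $(\gamma)_0=1$. The ML-generalized beta function is ${}^{ML}B_{p}(x,y)=\int_{0}^{1}t^{x-1}(1-t)^{y-1}E_{\alpha,\beta}^{\gamma}\left(-\frac{p}{t(1-t)}\right)dt$ for $\mathrm{Re}(x)>0$, $\mathrm{Re}(y)>0$ (the parameters $\alpha,\beta,\gamma$ are suppressed in the notation), ${}^{ML}\Gamma(s)=\int_0^\infty u^{s-1}E_{\alpha,\beta}^{\gamma}(-u)\,du$, and $B(x,y)=\int_0^1 t^{x-1}(1-t)^{y-1}dt$ is the classical beta function. The ML-generalized confluent hypergeometric function is ${}^{ML}\Phi_{p}(b;c;z)=\sum_{n=0}^{\infty}\frac{{}^{ML}B_{p}(b+n,c-b)}{B(b,c-b)}\frac{z^n}{n!}$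 for $p\ge 0$, $\mathrm{Re}(c)>\mathrm{Re}(b)>0$, $\mathrm{Re}(\alpha)>0$. The classical confluent hypergeometric function is $\Phi(b;c;z)=\sum_{n=0}^\infty\frac{(b)_n}{(c)_n}\frac{z^n}{n!}$.
   Formalization: The integral defining ML-Gamma(s) is assumed to converge (conditionally suffices); without this the right-hand side can be undefined, e.g. α=2, β=γ=1 gives E(-u)=cos(√u), whose ML-Gamma(s) diverges for Re(s)≥1/2. *)

theory Defs
  imports "HOL-Analysis.Analysis"
begin

text \<open>
  Integrals are gauge (Henstock-Kurzweil) integrals. They agree with the Lebesgue integral where the
  latter exists, and by Hake's theorem a convergent improper Riemann integral is a gauge integral
  too, so that being integrable is the same as being convergent for the integrands below.
  The endpoint value of an integrand is irrelevant; here it is always 0, as \<open>0 powr x = 0\<close>.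
\<close>

text \<open>
  \<open>Gamma\<close> is 0 at its poles and division by 0 gives 0, so terms with
  \<open>\<alpha> * n + \<beta>\<close> a nonpositive integer vanish, which is the usual convention
  \<open>1 / Gamma = 0\<close> there.
\<close>

definition mittag_leffler3 :: "complex \<Rightarrow> complex \<Rightarrow> complex \<Rightarrow> complex \<Rightarrow> complex" where
  "mittag_leffler3 \<alpha> \<beta> \<gamma> z =
     (\<Sum>n. pochhammer \<gamma> n / Gamma (\<alpha> * of_nat n + \<beta>) * (z ^ n / fact n))"

definition MLBeta ::
  "complex \<Rightarrow> complex \<Rightarrow> complex \<Rightarrow> real \<Rightarrow> complex \<Rightarrow> complex \<Rightarrow> complex" where
  "MLBeta \<alpha> \<beta> \<gamma> p x y =
     integral {0..1} (\<lambda>t. of_real t powr (x - 1) * of_real (1 - t) powr (y - 1) *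
                          mittag_leffler3 \<alpha> \<beta> \<gamma> (- of_real (p / (t * (1 - t)))))"

definition MLGamma_integrand ::
  "complex \<Rightarrow> complex \<Rightarrow> complex \<Rightarrow> complex \<Rightarrow> real \<Rightarrow> complex" where
  "MLGamma_integrand \<alpha> \<beta> \<gamma> s u = of_real u powr (s - 1) * mittag_leffler3 \<alpha> \<beta> \<gamma> (- of_real u)"

definition MLGamma :: "complex \<Rightarrow> complex \<Rightarrow> complex \<Rightarrow> complex \<Rightarrow> complex" where
  "MLGamma \<alpha> \<beta> \<gamma> s = integral {0..} (MLGamma_integrand \<alpha> \<beta> \<gamma> s)"

text \<open>
  Euler's integral; the library constant \<open>Beta\<close> is instead defined as a quotient of Gamma values.
\<close>

definition Euler_beta :: "complex \<Rightarrow> complex \<Rightarrow> complex" where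
  "Euler_beta x y =
     integral {0..1} (\<lambda>t. of_real t powr (x - 1) * of_real (1 - t) powr (y - 1))"

definition MLPhi ::
  "complex \<Rightarrow> complex \<Rightarrow> complex \<Rightarrow> real \<Rightarrow> complex \<Rightarrow> complex \<Rightarrow> complex \<Rightarrow> complex" where
  "MLPhi \<alpha> \<beta> \<gamma> p b c z =
     (\<Sum>n. MLBeta \<alpha> \<beta> \<gamma> p (b + of_nat n) (c - b) / Euler_beta b (c - b) * (z ^ n / fact n))"

definition confluent_hypergeometric :: "complex \<Rightarrow> complex \<Rightarrow> complex \<Rightarrow> complex" where
  "confluent_hypergeometric b c z =
     (\<Sum>n. pochhammer b n / pochhammer c n * (z ^ n / fact n))"

definition mellin_integrand :: "(real \<Rightarrow> complex) \<Rightarrow> complex \<Rightarrow> real \<Rightarrow> complex" where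
  "mellin_integrand f s p = of_real p powr (s - 1) * f p"

definition mellin_transform :: "(real \<Rightarrow> complex) \<Rightarrow> complex \<Rightarrow> complex" where
  "mellin_transform f s = integral {0..} (mellin_integrand f s)"

end

theory Submission
  imports Defs
begin

text \<open>
  Formally, one substitutes \<open>u = p / (t * (1 - t))\<close> after exchanging the \<open>p\<close>-integral with the sum and
  the \<open>t\<close>-integral. The difficulty is that the integral defining \<open>MLGamma\<close> may converge only
  conditionally, so that Fubini's theorem does not apply. Instead one works with the primitive
  \<open>F u = integral {0..u} f\<close> of \<open>f u = u powr (s - 1) * e u\<close>, where \<open>e u\<close> is the Mittag-Leffler function at
  \<open>- u\<close>: it is bounded, is \<open>O(u powr Re s)\<close>, and tends to \<open>MLGamma\<close>. After an integration by parts in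
  \<open>t\<close> near the endpoints these bounds show that the \<open>t\<close>-integrals converge, with tails that are small
  uniformly in \<open>p\<close>. Away from the endpoints Leibniz' rule gives
  \<open>d/dp (w powr s * F (p / w)) = p powr (s - 1) * e (p / w)\<close> with \<open>w = t * (1 - t)\<close>, and hence, for each
  finite upper limit \<open>P\<close>, the \<open>p\<close>-integral up to \<open>P\<close> becomes an absolutely convergent integral
  against \<open>F (P / w)\<close>. By dominated convergence one lets the cut-off in \<open>t\<close> vanish, sums over \<open>n\<close>, and
  lets \<open>P\<close> tend to infinity.

  Continuity of \<open>e\<close> requires the Mittag-Leffler series to converge everywhere, also for non-real \<open>\<alpha>\<close>.
  There the product formula for \<open>1 / Gamma\<close> costs at most a factor \<open>exp (y\<^sup>2 / x)\<close> against the real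
  argument \<open>x\<close>, which the superexponential growth of \<open>Gamma x\<close> absorbs.
\<close>

section \<open>Entireness of the Mittag-Leffler function\<close>

text \<open>With y = Im z and r = Re z + n, each factor satisfies |z + n|^2 = r^2 (1 + y^2 / r^2) <=
  r^2 exp (y^2 / r^2), and 1 / r^2 <= 1 / (r - 1) - 1 / r telescopes. The exponent keeps its
  telescoped form so that the induction closes.\<close>

lemma norm_pochhammer_le:
  fixes z :: complex
  assumes "Re z > 1"
  shows "norm (pochhammer z n) \<le> pochhammer (Re z) n *
           exp ((Im z)\<^sup>2 / 2 * (1 / (Re z - 1) - 1 / (Re z + n - 1)))"
proof (induction n)
  case 0
  then show ?case by simp
next
  case (Suc n)
  define r where "r = Re z + n"
  define d where "d = 1 / (r - 1) - 1 / r"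
  have r: "r > 1" using assms by (simp add: r_def)
  have "1 / r\<^sup>2 \<le> 1 / ((r - 1) * r)"
    using r by (intro divide_left_mono) (auto simp: power2_eq_square)
  also have "\<dots> = d" using r by (simp add: d_def field_simps)
  finally have d: "1 / r\<^sup>2 \<le> d" .
  have "(norm (z + of_nat n))\<^sup>2 = r\<^sup>2 * (1 + (Im z)\<^sup>2 * (1 / r\<^sup>2))"
    using r by (simp add: cmod_power2 r_def field_simps)
  also have "\<dots> \<le> r\<^sup>2 * exp ((Im z)\<^sup>2 * (1 / r\<^sup>2))"
    by (intro mult_left_mono exp_ge_add_one_self) auto
  also have "\<dots> \<le> r\<^sup>2 * exp ((Im z)\<^sup>2 * d)"
    using mult_left_mono [OF d, of "(Im z)\<^sup>2"] by (intro mult_left_mono) simp_all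
  also have "\<dots> = (r * exp ((Im z)\<^sup>2 / 2 * d))\<^sup>2"
    by (simp add: power_mult_distrib flip: exp_double)
  finally have "norm (z + of_nat n) \<le> r * exp ((Im z)\<^sup>2 / 2 * d)"
    using r by (simp add: power_mono_iff)
  then have "norm (pochhammer z (Suc n)) \<le>
    (pochhammer (Re z) n * exp ((Im z)\<^sup>2 / 2 * (1 / (Re z - 1) - 1 / (Re z + n - 1)))) *
      (r * exp ((Im z)\<^sup>2 / 2 * d))"
    unfolding pochhammer_Suc norm_mult using assms
    by (intro mult_mono Suc.IH) (auto intro!: mult_nonneg_nonneg pochhammer_nonneg)
  also have "\<dots> = pochhammer (Re z) (Suc n) *
      exp ((Im z)\<^sup>2 / 2 * (1 / (Re z - 1) - 1 / (Re z + n - 1)) + (Im z)\<^sup>2 / 2 * d)"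
    by (simp add: pochhammer_Suc r_def exp_add)
  also have "(Im z)\<^sup>2 / 2 * (1 / (Re z - 1) - 1 / (Re z + n - 1)) + (Im z)\<^sup>2 / 2 * d =
      (Im z)\<^sup>2 / 2 * (1 / (Re z - 1) - 1 / (Re z + Suc n - 1))"
    unfolding distrib_left [symmetric] d_def r_def by (simp add: algebra_simps)
  finally show ?case .
qed

text \<open>The factorwise bound is applied to the products converging to \<open>rGamma\<close>. For
  Re z >= 2 the telescoped exponent stays below (Im z)^2 / Re z, uniformly in n.\<close>

lemma norm_rGamma_le:
  fixes z :: complex
  assumes "Re z \<ge> 2"
  shows "norm (rGamma z) \<le> rGamma (Re z) * exp ((Im z)\<^sup>2 / Re z)"
proof (rule LIMSEQ_le)
  show "(\<lambda>n. norm (rGamma_series z n)) \<longlonglongrightarrow> norm (rGamma z)"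
    by (intro tendsto_intros)
  show "(\<lambda>n. rGamma_series (Re z) n * exp ((Im z)\<^sup>2 / Re z)) \<longlonglongrightarrow> rGamma (Re z) * exp ((Im z)\<^sup>2 / Re z)"
    by (intro tendsto_intros)
  have "norm (rGamma_series z n) \<le> rGamma_series (Re z) n * exp ((Im z)\<^sup>2 / Re z)" for n
  proof -
    have "1 / (Re z - 1) - 1 / (Re z + real (n + 1) - 1) \<le> 1 / (Re z - 1)"
      using assms by auto
    also have "\<dots> \<le> 2 / Re z" using assms by (simp add: field_simps)
    finally have "(Im z)\<^sup>2 / 2 * (1 / (Re z - 1) - 1 / (Re z + real (n + 1) - 1)) \<le> (Im z)\<^sup>2 / 2 * (2 / Re z)"
      by (intro mult_left_mono) auto
    then have "exp ((Im z)\<^sup>2 / 2 * (1 / (Re z - 1) - 1 / (Re z + real (n + 1) - 1))) \<le> exp ((Im z)\<^sup>2 / Re z)"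
      by simp
    then have "norm (pochhammer z (n + 1)) \<le> pochhammer (Re z) (n + 1) * exp ((Im z)\<^sup>2 / Re z)"
      using assms
      by (intro order_trans [OF norm_pochhammer_le] mult_left_mono pochhammer_nonneg) auto
    then show ?thesis
      by (simp add: rGamma_series_def norm_divide norm_mult divide_right_mono)
  qed
  then show "\<exists>N. \<forall>n\<ge>N. norm (rGamma_series z n) \<le> rGamma_series (Re z) n * exp ((Im z)\<^sup>2 / Re z)"
    by blast
qed

text \<open>Only the part of Euler's integral over [M, M + 1] is kept. Since M is free, Gamma
  outgrows every geometric rate.\<close>

lemma Gamma_real_ge:
  fixes x M :: real
  assumes "x \<ge> 1" and "M > 0"
  shows "M powr (x - 1) / exp (M + 1) \<le> Gamma x"
proof -
  have G: "((\<lambda>t. t powr (x - 1) / exp t) has_integral Gamma x) {0..}"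
    using assms by (intro Gamma_integral_real) auto
  have c: "((\<lambda>t. M powr (x - 1) / exp (M + 1)) has_integral M powr (x - 1) / exp (M + 1)) {M..M+1}"
    using has_integral_const_real [of "M powr (x - 1) / exp (M + 1)" M "M + 1"] by simp
  have "((\<lambda>t. if t \<in> {M..M+1} then M powr (x - 1) / exp (M + 1) else 0) has_integral
      M powr (x - 1) / exp (M + 1)) {0..}"
    using c assms by (subst has_integral_restrict) auto
  from this G show ?thesis
    by (rule has_integral_le) (use assms in \<open>auto intro!: frac_le powr_mono2\<close>)
qed

text \<open>The quotient is a product of factors (\<gamma> + k) / (k + 1), each of modulus at most
  |\<gamma>| + 1.\<close>

lemma norm_pochhammer_div_fact_le:
  fixes \<gamma> :: complex
  shows "norm (pochhammer \<gamma> n / fact n) \<le> (norm \<gamma> + 1) ^ n"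
proof (induction n)
  case (Suc n)
  have "norm (\<gamma> + of_nat n) \<le> norm \<gamma> + n"
    by (metis norm_of_nat norm_triangle_ineq)
  also have "\<dots> \<le> (norm \<gamma> + 1) * Suc n"
    by (simp add: algebra_simps)
  finally have "norm ((\<gamma> + of_nat n) / of_nat (Suc n)) \<le> norm \<gamma> + 1"
    by (simp add: norm_divide field_simps del: of_nat_Suc)
  moreover have "pochhammer \<gamma> (Suc n) / fact (Suc n) =
      (pochhammer \<gamma> n / fact n) * ((\<gamma> + of_nat n) / of_nat (Suc n))"
    by (simp add: pochhammer_Suc field_simps)
  ultimately show ?case
    using Suc by (simp only: norm_mult power_Suc2) (intro mult_mono, auto)
qed simp

lemma mittag_leffler3_summable:
  fixes \<alpha> \<beta> \<gamma> z :: complex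
  assumes "Re \<alpha> > 0"
  shows "summable (\<lambda>n. pochhammer \<gamma> n / Gamma (\<alpha> * of_nat n + \<beta>) / fact n * z ^ n)"
proof -
  define a where "a = Re \<alpha>"
  define x where "x = (\<lambda>n. a * real n + Re \<beta>)"
  \<comment> \<open>Chosen so that |Im w| <= K * Re w for w = \<alpha> n + \<beta> and large n; the
    factor lost in the bound on \<open>rGamma\<close> is then only geometric in n.\<close>
  define K where "K = 2 * (\<bar>Im \<alpha>\<bar> + \<bar>Im \<beta>\<bar>) / a"
  define R where "R = (norm \<gamma> + 1) * norm z"
  \<comment> \<open>The terms will have ratio R * exp (K^2 a) / q, which this choice makes at most
    1/2; the added 1 keeps q positive when R = 0. Then M is the number with M powr a = q.\<close>
  define q where "q = 2 * R * exp (K\<^sup>2 * a) + 1"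
  define M where "M = q powr (1 / a)"
  define C where "C = exp (M + 1) * M * exp (K\<^sup>2 * Re \<beta>) * M powr (- Re \<beta>)"
  have a: "a > 0" using assms by (simp add: a_def)
  have K: "K \<ge> 0" using a by (simp add: K_def)
  have R: "R \<ge> 0" by (simp add: R_def)
  have q: "q > 0" using R by (simp add: q_def add_nonneg_pos)
  have M: "M > 0" using q by (simp add: M_def)
  have Ma: "M powr a = q" using a q by (simp add: M_def powr_powr)
  have "filterlim (\<lambda>n. a * real n) at_top sequentially"
    using a by (simp add: filterlim_tendsto_pos_mult_at_top [OF tendsto_const] filterlim_real_sequentially)
  \<comment> \<open>The threshold yields both x n >= 2, as the bound on \<open>rGamma\<close>
    requires, and 2 * x n >= a * n.\<close>
  then have "eventually (\<lambda>n. a * real n \<ge> 2 * (2 + \<bar>Re \<beta>\<bar>)) sequentially"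
    by (simp add: filterlim_at_top)
  moreover have "eventually (\<lambda>n. n \<ge> (1::nat)) sequentially" by (rule eventually_ge_at_top)
  ultimately have "eventually (\<lambda>n. norm (pochhammer \<gamma> n / Gamma (\<alpha> * of_nat n + \<beta>) / fact n * z ^ n)
      \<le> C * (1/2) ^ n) sequentially"
  proof eventually_elim
    case (elim n)
    define w where "w = \<alpha> * of_nat n + \<beta>"
    have Rew: "Re w = x n" by (simp add: w_def x_def a_def)
    have x2: "x n \<ge> 2 \<and> 2 * x n \<ge> a * real n"
      using elim abs_ge_minus_self [of "Re \<beta>"] by (auto simp: x_def)
    have "\<bar>Im w\<bar> \<le> \<bar>Im \<alpha>\<bar> * real n + \<bar>Im \<beta>\<bar>"
      by (simp add: w_def abs_mult order_trans [OF abs_triangle_ineq])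
    also have "\<dots> \<le> (\<bar>Im \<alpha>\<bar> + \<bar>Im \<beta>\<bar>) * real n"
      using elim mult_left_mono [of 1 "real n" "\<bar>Im \<beta>\<bar>"] by (simp add: algebra_simps)
    also have "\<dots> = K * (a * real n / 2)" using a by (simp add: K_def)
    also have "\<dots> \<le> K * x n" using x2 K by (intro mult_left_mono) auto
    finally have "\<bar>Im w\<bar>\<^sup>2 \<le> (K * x n)\<^sup>2" by (intro power_mono) auto
    then have "(Im w)\<^sup>2 / x n \<le> (K * x n)\<^sup>2 / x n"
      using x2 by (intro divide_right_mono) auto
    also have "\<dots> = K\<^sup>2 * x n" using x2 by (simp add: power2_eq_square)
    finally have e: "exp ((Im w)\<^sup>2 / x n) \<le> exp (K\<^sup>2 * x n)" by simp
    have rG: "rGamma (x n) \<le> exp (M + 1) * (M * M powr (- x n))"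
    proof -
      have "inverse (Gamma (x n)) \<le> inverse (M powr (x n - 1) / exp (M + 1))"
        using x2 M by (intro le_imp_inverse_le Gamma_real_ge) auto
      then show ?thesis
        using M by (simp add: rGamma_inverse_Gamma powr_diff powr_minus field_simps)
    qed
    have "norm (rGamma w) \<le> rGamma (x n) * exp ((Im w)\<^sup>2 / x n)"
      using norm_rGamma_le [of w] x2 by (simp add: Rew)
    also have "\<dots> \<le> (exp (M + 1) * (M * M powr (- x n))) * exp (K\<^sup>2 * x n)"
      using rG e M by (intro mult_mono) auto
    finally have g: "norm (rGamma w) \<le> (exp (M + 1) * (M * M powr (- x n))) * exp (K\<^sup>2 * x n)" .
    have "norm (pochhammer \<gamma> n / Gamma w / fact n * z ^ n) =
        norm (pochhammer \<gamma> n / fact n) * norm (rGamma w) * norm z ^ n"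
      by (simp add: norm_mult norm_divide norm_power rGamma_inverse_Gamma norm_inverse field_simps)
    also have "\<dots> \<le> (norm \<gamma> + 1) ^ n * ((exp (M + 1) * (M * M powr (- x n))) * exp (K\<^sup>2 * x n)) * norm z ^ n"
      using g M by (intro mult_right_mono mult_mono norm_pochhammer_div_fact_le) auto
    also have "\<dots> = exp (M + 1) * M * exp (K\<^sup>2 * x n) * M powr (- x n) * R ^ n"
      by (simp add: R_def power_mult_distrib mult_ac)
    also have "exp (K\<^sup>2 * x n) = exp (K\<^sup>2 * Re \<beta>) * exp (K\<^sup>2 * a) ^ n"
      by (simp add: x_def algebra_simps exp_add flip: exp_of_nat_mult)
    also have "M powr (- x n) = M powr (- Re \<beta>) / q ^ n"
    proof -
      have "M powr (- x n) = M powr (- Re \<beta>) / M powr (a * real n)"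
        using M by (simp add: x_def powr_add powr_minus field_simps powr_diff)
      also have "M powr (a * real n) = q ^ n"
        using M q by (simp flip: Ma powr_powr powr_realpow)
      finally show ?thesis .
    qed
    also have "exp (M + 1) * M * (exp (K\<^sup>2 * Re \<beta>) * exp (K\<^sup>2 * a) ^ n) * (M powr (- Re \<beta>) / q ^ n) * R ^ n
        = C * (exp (K\<^sup>2 * a) * R / q) ^ n"
      by (simp add: C_def power_mult_distrib power_divide mult_ac)
    also have "\<dots> \<le> C * (1/2) ^ n"
    proof (intro mult_left_mono power_mono)
      show "exp (K\<^sup>2 * a) * R / q \<le> 1/2"
        using q by (simp add: field_simps) (simp add: q_def mult_ac)
    qed (use M R q in \<open>auto simp: C_def\<close>)
    finally show ?case unfolding w_def .
  qed
  then show ?thesis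
    by (rule summable_comparison_test_ev) (intro summable_mult summable_geometric, simp)
qed

lemma continuous_on_mittag_leffler3:
  assumes "Re \<alpha> > 0"
  shows "continuous_on A (mittag_leffler3 \<alpha> \<beta> \<gamma>)"
proof -
  have "isCont (\<lambda>z. \<Sum>n. (pochhammer \<gamma> n / Gamma (\<alpha> * of_nat n + \<beta>) / fact n) * z ^ n) z" for z
    by (rule isCont_powser_converges_everywhere) (rule mittag_leffler3_summable [OF assms])
  then show ?thesis
    unfolding mittag_leffler3_def by (simp add: continuous_at_imp_continuous_on)
qed

section \<open>Gauge integrals and complex powers\<close>

text \<open>Hake's theorem on the half-line: a box containing a large ball around 0 starts left of 0
  and ends beyond N, so the integral over it is \<open>G b\<close>. Conditionally convergent
  integrals are covered.\<close>

lemma has_integral_at_topI: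
  fixes f :: "real \<Rightarrow> complex"
  assumes int: "\<And>u. u \<ge> 0 \<Longrightarrow> (f has_integral G u) {0..u}"
    and lim: "(G \<longlongrightarrow> l) at_top"
  shows "(f has_integral l) {0..}"
  unfolding has_integral_alt'
proof (intro conjI allI impI)
  fix a b :: real
  have "f integrable_on {0..} \<inter> {a..b}"
  proof (cases "b \<ge> 0")
    case True
    have "f integrable_on {max 0 a..b}"
      by (rule integrable_on_subinterval [OF has_integral_integrable [OF int [OF True]]]) auto
    moreover have "{0..} \<inter> {a..b} = {max 0 a..b}" by auto
    ultimately show ?thesis by simp
  next
    case False
    then have "{0..} \<inter> {a..b} = {}" by auto
    then show ?thesis by (metis integrable_on_empty)
  qed
  then show "(\<lambda>x. if x \<in> {0..} then f x else 0) integrable_on cbox a b"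
    unfolding integrable_on_def has_integral_restrict_Int cbox_interval .
next
  fix \<epsilon> :: real
  assume "\<epsilon> > 0"
  then obtain N where N: "\<And>u. u \<ge> N \<Longrightarrow> norm (G u - l) < \<epsilon>"
    using lim by (auto simp: tendsto_iff eventually_at_top_linorder dist_norm)
  define B where "B = max 1 N"
  have "norm (integral (cbox a b) (\<lambda>x. if x \<in> {0..} then f x else 0) - l) < \<epsilon>"
    if ab: "ball 0 B \<subseteq> cbox a b" for a b
  proof -
    have "0 \<in> ball 0 B" by (simp add: B_def)
    then have a: "a \<le> 0" "b \<ge> 0" using ab by (auto simp: subset_iff)
    have b: "b \<ge> B"
    proof (rule ccontr)
      assume "\<not> B \<le> b"
      \<comment> \<open>If b < B, this midpoint lies in the ball but to the right of b.\<close>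
      then have "(b + B) / 2 \<in> ball 0 B" using a by (auto simp: dist_norm)
      then have "(b + B) / 2 \<in> cbox a b" using ab by blast
      then have "(b + B) / 2 \<le> b" by simp
      then show False using \<open>\<not> B \<le> b\<close> by simp
    qed
    have "{0..} \<inter> {a..b} = {0..b}" using a by auto
    then have "((\<lambda>x. if x \<in> {0..} then f x else 0) has_integral G b) (cbox a b)"
      unfolding has_integral_restrict_Int cbox_interval using int [OF a(2)] by (simp only:)
    then show ?thesis
      using N [of b] b by (simp add: integral_unique B_def)
  qed
  then show "\<exists>B>0. \<forall>a b. ball 0 B \<subseteq> cbox a b \<longrightarrow>
      norm (integral (cbox a b) (\<lambda>x. if x \<in> {0..} then f x else 0) - l) < \<epsilon>"
    by (intro exI [of _ B]) (auto simp: B_def)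
qed

text \<open>The converse direction: for u >= B the box from -B to u contains the ball of radius B,
  and the integrand is zero on its negative part.\<close>

lemma tendsto_integral_at_top:
  fixes f :: "real \<Rightarrow> complex"
  assumes "f integrable_on {0..}"
  shows "((\<lambda>u. integral {0..u} f) \<longlongrightarrow> integral {0..} f) at_top"
proof (rule tendstoI)
  fix \<epsilon> :: real
  assume "\<epsilon> > 0"
  moreover have "(f has_integral integral {0..} f) {0..}"
    using assms by (simp add: has_integral_integral)
  ultimately obtain B where B: "B > 0" and *: "\<And>a b. ball 0 B \<subseteq> cbox a b \<Longrightarrow>
      norm (integral (cbox a b) (\<lambda>x. if x \<in> {0..} then f x else 0) - integral {0..} f) < \<epsilon>"
    unfolding has_integral_alt' by blast
  show "\<forall>\<^sub>F u in at_top. dist (integral {0..u} f) (integral {0..} f) < \<epsilon>"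
    using eventually_ge_at_top [of B]
  proof eventually_elim
    case (elim u)
    have "ball 0 B \<subseteq> cbox (- B) u" using elim by (auto simp: dist_norm)
    moreover have "{0..} \<inter> {-B..u} = {0..u}" using B by auto
    then have "integral (cbox (- B) u) (\<lambda>x. if x \<in> {0..} then f x else 0) = integral {0..u} f"
      unfolding integral_restrict_Int cbox_interval by (simp only:)
    ultimately show ?case using * by (metis dist_norm)
  qed
qed

text \<open>Endpoints form a null set, so continuity and the majorant are required only inside; the
  integrands below may be singular at the endpoints.\<close>

lemma
  fixes f :: "real \<Rightarrow> complex"
  assumes cont: "continuous_on {a<..<b} f"
    and bound: "\<And>t. t \<in> {a<..<b} \<Longrightarrow> norm (f t) \<le> g t"
    and g: "g integrable_on {a..b}"
  shows integrable_on_dominated_Ioo: "f integrable_on {a..b}"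
    and norm_integral_dominated_Ioo: "norm (integral {a..b} f) \<le> integral {a..b} g"
proof -
  have g': "g integrable_on {a<..<b}" using g by (simp add: integrable_on_open_interval_real)
  have f: "f integrable_on {a<..<b}"
    by (rule measurable_bounded_by_integrable_imp_integrable [OF _ g' bound])
       (auto intro: continuous_imp_measurable_on_sets_lebesgue [OF cont])
  then show "f integrable_on {a..b}" by (simp add: integrable_on_open_interval_real)
  show "norm (integral {a..b} f) \<le> integral {a..b} g"
    unfolding integral_open_interval_real using f g' bound by (rule integral_norm_bound_integral)
qed

lemma has_integral_reflect_unit:
  fixes f :: "real \<Rightarrow> complex"
  assumes "(f has_integral I) {a..b}"
  shows "((\<lambda>t. f (1 - t)) has_integral I) {1 - b..1 - a}"
proof -
  have "((\<lambda>t. f (- t)) has_integral I) {- b..- a}"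
    using assms by simp
  from has_integral_shift_real_ivl [OF this, of "-1"] show ?thesis by (simp add: algebra_simps)
qed

lemma norm_of_real_powr:
  assumes "t \<ge> 0"
  shows "norm (complex_of_real t powr x) = t powr Re x"
  using assms by (simp add: norm_powr_real_powr)

lemma continuous_on_of_real_powr [continuous_intros]:
  fixes f :: "'a::topological_space \<Rightarrow> real"
  assumes "continuous_on A f" and "\<And>t. t \<in> A \<Longrightarrow> f t > 0"
  shows "continuous_on A (\<lambda>t. complex_of_real (f t) powr x)"
proof -
  have "continuous_on A (\<lambda>t. exp (x * of_real (ln (f t))))"
    using assms by (intro continuous_intros) force+
  then show ?thesis
    using assms(2) by (elim continuous_on_eq) (auto simp: powr_def Ln_of_real less_imp_neq [symmetric])
qed

lemma of_real_powr_divide: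
  assumes "p > 0" "w > 0"
  shows "complex_of_real (p / w) powr z = of_real p powr z / of_real w powr z"
  using assms by (simp add: powr_def Ln_of_real ln_div algebra_simps flip: of_real_divide exp_diff)

lemma of_real_powr_mult:
  assumes "p > 0" "w > 0"
  shows "complex_of_real (p * w) powr z = of_real p powr z * of_real w powr z"
  using assms by (simp add: powr_def Ln_of_real ln_mult algebra_simps flip: of_real_mult exp_add)

text \<open>The base is at most 1 and the exponent at least -1, so (1 - t) powr (-1) is a bound
  independent of a.\<close>

lemma powr_minus_one_le_two:
  fixes t a :: real
  assumes "0 \<le> t" "t \<le> 1/2" "a \<ge> 0"
  shows "(1 - t) powr (a - 1) \<le> 2"
proof -
  have "(1 - t) powr (a - 1) \<le> (1 - t) powr (- 1)"
    using assms by (intro powr_mono') auto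
  also have "\<dots> = 1 / (1 - t)" using assms by (simp add: powr_minus field_simps)
  also have "\<dots> \<le> 2" using assms by (simp add: field_simps)
  finally show ?thesis .
qed

section \<open>Kernels with a conditionally convergent Mellin transform\<close>

text \<open>The Mittag-Leffler function enters only through the continuity of \<open>e\<close> and
  the possibly conditional convergence of its Mellin integral.\<close>

locale mellin_kernel =
  fixes s :: complex and e :: "real \<Rightarrow> complex"
  assumes Re_s: "Re s > 0"
    and continuous_e: "continuous_on UNIV e"
    and converges: "(\<lambda>u. of_real u powr (s - 1) * e u) integrable_on {0..}"
begin

section \<open>The primitive of the Mellin integrand\<close>

definition f :: "real \<Rightarrow> complex" where
  "f u = of_real u powr (s - 1) * e u"

definition F :: "real \<Rightarrow> complex" where
  "F u = integral {0..u} f"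

definition L :: complex where
  "L = integral {0..} f"

lemma continuous_on_e [continuous_intros]:
  "continuous_on A g \<Longrightarrow> continuous_on A (\<lambda>x. e (g x))"
  using continuous_on_compose2 [OF continuous_e] by blast

lemma f_integrable: "f integrable_on {0..u}"
  using converges unfolding f_def [abs_def, symmetric]
  by (rule integrable_on_subinterval) auto

lemma F_nonpos: "u \<le> 0 \<Longrightarrow> F u = 0"
  by (cases "u = 0") (auto simp: F_def)

lemma F_tendsto: "(F \<longlongrightarrow> L) at_top"
  unfolding F_def L_def using converges
  by (intro tendsto_integral_at_top) (simp add: f_def [abs_def])

lemma F_deriv:
  assumes "u > 0"
  shows "(F has_vector_derivative f u) (at u)"
proof -
  have c: "continuous_on {0<..} f"
    unfolding f_def [abs_def] by (intro continuous_intros) auto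
  then have "isCont f u" using assms by (simp add: continuous_on_eq_continuous_at)
  from continuous_at_imp_continuous_at_within [OF this]
  \<comment> \<open>Working on [0, u + 1] makes u an interior point.\<close>
  have "((\<lambda>u. integral {0..u} f) has_vector_derivative f u) (at u within ({0..u + 1} - {}))"
    using assms by (intro integral_has_vector_derivative_continuous_at [OF f_integrable]) auto
  then have "((\<lambda>u. integral {0..u} f) has_vector_derivative f u) (at u)"
    using assms by (simp add: at_within_Icc_at)
  then show ?thesis unfolding F_def [abs_def] .
qed

lemma continuous_on_F [continuous_intros]:
  assumes "continuous_on A g" and "\<And>x. x \<in> A \<Longrightarrow> g x > 0"
  shows "continuous_on A (\<lambda>x. F (g x))"
proof -
  have "continuous_on {0<..} F"
    using F_deriv by (intro continuous_at_imp_continuous_on ballI)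
      (auto intro: has_vector_derivative_continuous)
  then show ?thesis
    using assms by (intro continuous_on_compose2 [of "{0<..}" F A g]) auto
qed

text \<open>Boundedness follows from the limit at infinity and continuity on compact intervals. Near
  0 the power bound comes from integrating |f u| <= E * u powr (Re s - 1); for u >= 1 it follows
  from boundedness.\<close>

lemma F_bound: "\<exists>C>0. \<forall>u\<ge>0. norm (F u) \<le> C \<and> norm (F u) \<le> C * u powr Re s"
proof -
  have "\<forall>\<^sub>F u in at_top. norm (F u) < norm L + 1"
    by (rule order_tendstoD) (auto intro: tendsto_norm F_tendsto)
  then obtain N where N: "\<And>u. u \<ge> N \<Longrightarrow> norm (F u) < norm L + 1"
    by (auto simp: eventually_at_top_linorder)
  have "continuous_on {0..N} F"
    unfolding F_def [abs_def] by (rule indefinite_integral_continuous_1 [OF f_integrable])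
  then have "bounded (F ` {0..N})"
    by (intro compact_imp_bounded compact_continuous_image) auto
  then obtain B where "\<forall>u\<in>{0..N}. norm (F u) \<le> B"
    by (auto simp: bounded_iff)
  then have B: "\<And>u. 0 \<le> u \<Longrightarrow> u \<le> N \<Longrightarrow> norm (F u) \<le> B" by simp
  \<comment> \<open>The entry \<open>norm L + 1\<close> controls F beyond N and also makes the final
    constant positive.\<close>
  define B' where "B' = max B (norm L + 1)"
  have B': "norm (F u) \<le> B'" if "u \<ge> 0" for u
    using B [OF that] N [of u] unfolding B'_def by (cases "u \<le> N") auto
  have "bounded (e ` {0..1})"
    by (intro compact_imp_bounded compact_continuous_image continuous_on_subset [OF continuous_e]) auto
  then obtain E where "\<forall>u\<in>{0..1}. norm (e u) \<le> E"
    by (auto simp: bounded_iff)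
  then have E: "\<And>u. 0 \<le> u \<Longrightarrow> u \<le> 1 \<Longrightarrow> norm (e u) \<le> E" by simp
  have small: "norm (F u) \<le> E / Re s * u powr Re s" if u: "0 \<le> u" "u \<le> 1" for u
  proof -
    have p: "((\<lambda>t. t powr (Re s - 1)) has_integral (u powr (Re s - 1 + 1) / (Re s - 1 + 1))) {0..u}"
      using Re_s u by (intro has_integral_powr_from_0) auto
    then have i: "((\<lambda>t. E * t powr (Re s - 1)) has_integral (E * (u powr Re s / Re s))) {0..u}"
      by (intro has_integral_mult_right) simp
    have "norm (integral {0..u} f) \<le> integral {0..u} (\<lambda>t. E * t powr (Re s - 1))"
      using E u by (intro integral_norm_bound_integral f_integrable has_integral_integrable [OF i])
        (auto simp: f_def norm_mult norm_of_real_powr mult.commute [of E] intro!: mult_left_mono)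
    then show ?thesis using integral_unique [OF i] by (simp add: F_def)
  qed
  define C where "C = max B' (E / Re s)"
  have "norm (F u) \<le> C \<and> norm (F u) \<le> C * u powr Re s" if u: "u \<ge> 0" for u
  proof
    show 1: "norm (F u) \<le> C" using B' [OF u] by (simp add: C_def)
    show "norm (F u) \<le> C * u powr Re s"
    proof (cases "u \<le> 1")
      case True
      have "E / Re s * u powr Re s \<le> C * u powr Re s"
        by (intro mult_right_mono) (auto simp: C_def)
      then show ?thesis using small [OF u True] by simp
    next
      case False
      then have "1 \<le> u powr Re s" using Re_s by (simp add: ge_one_powr_ge_zero)
      moreover have "C \<ge> 0" using 1 norm_ge_zero order_trans by blast
      ultimately show ?thesis using 1 mult_left_mono [of 1 "u powr Re s" C] by simp
    qed
  qed
  moreover have "C > 0" by (simp add: C_def B'_def less_max_iff_disj add_nonneg_pos)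
  ultimately show ?thesis by blast
qed

text \<open>Fixed by choice once, so that all later estimates share one constant.\<close>

definition C :: real where
  "C = (SOME C. C > 0 \<and> (\<forall>u\<ge>0. norm (F u) \<le> C \<and> norm (F u) \<le> C * u powr Re s))"

lemma C_pos: "C > 0"
  and norm_F_le_nonneg: "u \<ge> 0 \<Longrightarrow> norm (F u) \<le> C"
  and norm_F_le_powr: "u \<ge> 0 \<Longrightarrow> norm (F u) \<le> C * u powr Re s"
  using someI_ex [OF F_bound] unfolding C_def by blast+

lemma norm_F_le: "norm (F u) \<le> C"
  using norm_F_le_nonneg [of u] F_nonpos [of u] C_pos by (cases "u \<ge> 0") auto

section \<open>The beta integrand and integration by parts in t\<close>

definition G :: "complex \<Rightarrow> complex \<Rightarrow> real \<Rightarrow> real \<Rightarrow> complex" where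
  "G x y p t = of_real t powr (x - 1) * of_real (1 - t) powr (y - 1) * e (p / (t * (1 - t)))"

text \<open>For 0 < t < 1 and p >= 0 this is the integral of q powr (s - 1) * G x y q t over q in
  [0, p]: substituting u = q / w with w = t * (1 - t) produces w powr s, which is absorbed into the
  two powers.\<close>

definition k :: "complex \<Rightarrow> complex \<Rightarrow> real \<Rightarrow> real \<Rightarrow> complex" where
  "k x y p t = of_real t powr (x + s - 1) * of_real (1 - t) powr (y + s - 1) * F (p / (t * (1 - t)))"

text \<open>
  With \<open>w = t * (1 - t)\<close>, the function \<open>H\<close> is the boundary term of the integration by parts that moves
  the derivative of \<open>F (p / w)\<close> in \<open>t\<close> onto the other factors of \<open>G\<close>; the division by
  \<open>w' = 1 - 2 * t\<close> confines it to \<open>t < 1/2\<close>. The derivative of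
  \<open>t powr (x + s) * (1 - t) powr (y + s) / (1 - 2 * t)\<close> is
  \<open>t powr (x + s - 1) * (1 - t) powr (y + s - 1) * m x y t\<close>.
\<close>

definition m :: "complex \<Rightarrow> complex \<Rightarrow> real \<Rightarrow> complex" where
  "m x y t = (x + s) * of_real ((1 - t) / (1 - 2 * t)) - (y + s) * of_real (t / (1 - 2 * t))
     + of_real (2 * t * (1 - t) / (1 - 2 * t)\<^sup>2)"

definition H :: "complex \<Rightarrow> complex \<Rightarrow> real \<Rightarrow> real \<Rightarrow> complex" where
  "H x y p t = of_real t powr (x + s) * of_real (1 - t) powr (y + s) / of_real (1 - 2 * t) * F (p / (t * (1 - t)))"

text \<open>By the chain rule F (p / w) contributes -p (1 - 2 t) / w^2 * f (p / w). The factor 1 - 2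
  t cancels the denominator of \<open>H\<close>, and the remaining powers combine to -(p powr s) *
  G.\<close>

lemma H_deriv:
  assumes t: "0 < t" "t < 1/2" and p: "p > 0"
  shows "(H x y p has_vector_derivative (k x y p t * m x y t - of_real p powr s * G x y p t)) (at t)"
proof -
  define T O' where "T = complex_of_real t" and "O' = complex_of_real (1 - t)"
  define d where "d = complex_of_real (1 - 2 * t)"
  define P where "P = complex_of_real p"
  have "T \<noteq> 0" "O' \<noteq> 0" "d \<noteq> 0" "P \<noteq> 0"
    using t p unfolding T_def O'_def d_def P_def of_real_eq_0_iff by auto
  then have nz: "T \<noteq> 0" "O' \<noteq> 0" "d \<noteq> 0" "P \<noteq> 0" "T powr s \<noteq> 0" "O' powr s \<noteq> 0"
    by auto
  have O': "1 - T = O'" and d: "1 - 2 * T = d" by (simp_all add: T_def O'_def d_def)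
  have nn: "T \<notin> \<real>\<^sub>\<le>\<^sub>0" "1 - T \<notin> \<real>\<^sub>\<le>\<^sub>0" "1 - 2 * T \<noteq> 0"
    using t nz(3) by (simp_all add: d) (simp_all add: T_def complex_nonpos_Reals_iff)
  define h' where "h' = (x + s) * T powr (x + s - 1) * O' powr (y + s) / d
      - (y + s) * T powr (x + s) * O' powr (y + s - 1) / d + 2 * T powr (x + s) * O' powr (y + s) / d\<^sup>2"
  have "((\<lambda>z. z powr (x + s) * (1 - z) powr (y + s) / (1 - 2 * z)) has_field_derivative h') (at T)"
    unfolding h'_def
    by (rule derivative_eq_intros refl nn | simp add: nn O' d)+
       (use nz in \<open>simp add: field_simps power2_eq_square\<close>)
  then have h: "((\<lambda>t. of_real t powr (x + s) * of_real (1 - t) powr (y + s) / of_real (1 - 2 * t))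
      has_vector_derivative h') (at t)"
    unfolding T_def using has_vector_derivative_real_field by fastforce
  have "((\<lambda>t. p / (t * (1 - t))) has_real_derivative (- (p * (1 - 2 * t)) / (t * (1 - t))\<^sup>2)) (at t)"
    using t by (auto intro!: derivative_eq_intros simp: field_simps power2_eq_square)
  then have "(F \<circ> (\<lambda>t. p / (t * (1 - t))) has_vector_derivative
      (- (p * (1 - 2 * t)) / (t * (1 - t))\<^sup>2) *\<^sub>R f (p / (t * (1 - t)))) (at t)"
    using t p by (intro vector_diff_chain_at F_deriv) (auto simp: has_real_derivative_iff_has_vector_derivative)
  from has_vector_derivative_mult [OF h this]
  have "(H x y p has_vector_derivative
      (T powr (x + s) * O' powr (y + s) / d) *
        ((- (p * (1 - 2 * t)) / (t * (1 - t))\<^sup>2) *\<^sub>R f (p / (t * (1 - t))))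
      + h' * F (p / (t * (1 - t)))) (at t)"
    by (simp add: H_def [abs_def] o_def T_def O'_def d_def)
  moreover have "h' * F (p / (t * (1 - t))) = k x y p t * m x y t"
  proof -
    have "T powr (x + s) = T * T powr (x + s - 1)" "O' powr (y + s) = O' * O' powr (y + s - 1)"
      using nz by (simp_all add: powr_diff)
    then have "h' = T powr (x + s - 1) * O' powr (y + s - 1) *
        ((x + s) * (O' / d) - (y + s) * (T / d) + 2 * T * O' / d\<^sup>2)"
      unfolding h'_def using nz by (simp add: field_simps)
    then show ?thesis
      by (simp add: k_def m_def T_def O'_def d_def)
  qed
  moreover have "(T powr (x + s) * O' powr (y + s) / d) *
        ((- (p * (1 - 2 * t)) / (t * (1 - t))\<^sup>2) *\<^sub>R f (p / (t * (1 - t))))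
      = - (of_real p powr s * G x y p t)"
  proof -
    define E where "E = e (p / (t * (1 - t)))"
    have "f (p / (t * (1 - t))) = of_real (p / (t * (1 - t))) powr s / of_real (p / (t * (1 - t))) * E"
      using p t by (simp add: f_def E_def powr_diff)
    also have "of_real (p / (t * (1 - t))) powr s = P powr s / (T powr s * O' powr s)"
      using p t by (simp add: of_real_powr_divide of_real_powr_mult P_def T_def O'_def del: of_real_divide of_real_mult of_real_diff)
    finally have f: "f (p / (t * (1 - t))) = P powr s / (T powr s * O' powr s) / (P / (T * O')) * E"
      by (simp add: P_def T_def O'_def)
    have T: "T powr (x + s) = T powr (x - 1) * T * T powr s" "O' powr (y + s) = O' powr (y - 1) * O' * O' powr s"
      using nz by (simp_all add: powr_diff powr_add)
    have sc: "(- (p * (1 - 2 * t)) / (t * (1 - t))\<^sup>2) *\<^sub>R f (p / (t * (1 - t)))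
        = - (P * d / (T * O')\<^sup>2) * f (p / (t * (1 - t)))"
      by (simp add: scaleR_conv_of_real P_def T_def O'_def d_def)
    have "G x y p t = T powr (x - 1) * O' powr (y - 1) * E"
      by (simp add: G_def T_def O'_def E_def)
    then show ?thesis
      unfolding sc unfolding f T P_def [symmetric] using nz by (simp add: field_simps power2_eq_square)
  qed
  ultimately show ?thesis by (simp add: algebra_simps)
qed

section \<open>Bounds for the terms of the integration by parts\<close>

lemma norm_k_le:
  assumes "0 < t" "t < 1"
  shows "norm (k x y p t) \<le> C * (t powr (Re x + Re s - 1) * (1 - t) powr (Re y + Re s - 1))"
proof -
  have "norm (k x y p t) = t powr (Re x + Re s - 1) * (1 - t) powr (Re y + Re s - 1) * norm (F (p / (t * (1 - t))))"
    unfolding k_def norm_mult using assms by (simp add: norm_of_real_powr del: of_real_diff)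
  also have "\<dots> \<le> t powr (Re x + Re s - 1) * (1 - t) powr (Re y + Re s - 1) * C"
    using assms by (intro mult_left_mono norm_F_le) auto
  finally show ?thesis by (simp add: mult_ac)
qed

text \<open>Here F (p / w) is bounded by C * (p / w) powr Re s, whose denominator cancels the extra
  powers in \<open>k\<close>. The scale p powr Re s matches the factor p powr s that multiplies
  \<open>G\<close> in the derivative of \<open>H\<close>.\<close>

lemma norm_k_le_powr:
  assumes "0 < t" "t < 1" "p \<ge> 0"
  shows "norm (k x y p t) \<le> C * p powr Re s * (t powr (Re x - 1) * (1 - t) powr (Re y - 1))"
proof -
  have "norm (k x y p t) = t powr (Re x + Re s - 1) * (1 - t) powr (Re y + Re s - 1) * norm (F (p / (t * (1 - t))))"
    unfolding k_def norm_mult using assms by (simp add: norm_of_real_powr del: of_real_diff)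
  also have "\<dots> \<le> t powr (Re x + Re s - 1) * (1 - t) powr (Re y + Re s - 1) *
      (C * (p / (t * (1 - t))) powr Re s)"
    using assms by (intro mult_left_mono norm_F_le_powr) auto
  also have "\<dots> = C * p powr Re s * (t powr (Re x - 1) * (1 - t) powr (Re y - 1))"
    using assms by (simp add: powr_divide powr_mult powr_add powr_diff)
  finally show ?thesis .
qed

lemma norm_H_le:
  assumes "0 < t" "t \<le> 1/4" "p \<ge> 0" "Re y \<ge> 0"
  shows "norm (H x y p t) \<le> 2 * C * p powr Re s * t powr Re x"
proof -
  have "norm (H x y p t) = t powr (Re x + Re s) * (1 - t) powr (Re y + Re s) / (1 - 2 * t) * norm (F (p / (t * (1 - t))))"
    unfolding H_def norm_mult norm_divide using assms by (simp add: norm_of_real_powr del: of_real_diff)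
  also have "\<dots> \<le> t powr (Re x + Re s) * (1 - t) powr (Re y + Re s) / (1 - 2 * t) *
      (C * (p / (t * (1 - t))) powr Re s)"
    using assms by (intro mult_left_mono norm_F_le_powr) auto
  also have "\<dots> = C * p powr Re s * t powr Re x * ((1 - t) powr Re y * (1 / (1 - 2 * t)))"
    using assms by (simp add: powr_divide powr_mult powr_add)
  also have "\<dots> \<le> C * p powr Re s * t powr Re x * (1 * 2)"
    using assms C_pos by (intro mult_left_mono mult_mono powr_le1) (auto simp: field_simps)
  finally show ?thesis by (simp add: mult_ac)
qed

text \<open>The growth is linear in x and y. It is the source of the weight 1 + n when x = b + n is
  summed over n.\<close>

lemma norm_m_le:
  assumes "0 \<le> t" "t \<le> 1/4"
  shows "norm (m x y t) \<le> 4 * (1 + norm s) * (1 + norm x + norm y)"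
proof -
  have 1: "(1 - t) / (1 - 2 * t) \<le> 2" "t / (1 - 2 * t) \<le> 1" using assms by (auto simp: field_simps)
  \<comment> \<open>This identity together with 1 - 2 t >= 1/2 bounds the last term of
    \<open>m\<close>.\<close>
  have "4 * (t * (1 - t)) + (1 - 2 * t)\<^sup>2 = 1" by (simp add: power2_eq_square algebra_simps)
  moreover have "(1/2)\<^sup>2 \<le> (1 - 2 * t)\<^sup>2" using assms by (intro power_mono) auto
  ultimately have 2: "2 * t * (1 - t) / (1 - 2 * t)\<^sup>2 \<le> 2"
    using assms by (simp add: divide_le_eq power2_eq_square)
  have "norm (m x y t) \<le> norm (x + s) * ((1 - t) / (1 - 2 * t)) + norm (y + s) * (t / (1 - 2 * t))
      + 2 * t * (1 - t) / (1 - 2 * t)\<^sup>2"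
    unfolding m_def using assms
    by (intro order_trans [OF norm_triangle_ineq] order_trans [OF norm_triangle_ineq4] add_mono)
       (simp_all add: norm_mult norm_divide norm_power flip: of_real_mult of_real_divide of_real_diff of_real_power)
  also have "\<dots> \<le> (norm x + norm s) * 2 + (norm y + norm s) * 1 + 2"
    using 1 2 assms by (intro add_mono mult_mono norm_triangle_ineq) auto
  also have "\<dots> \<le> 4 * (1 + norm s) * (1 + norm x + norm y)"
    by (simp add: algebra_simps)
  finally show ?thesis .
qed

lemma continuous_on_G:
  "continuous_on A (G x y p)" if "A \<subseteq> {0<..<1}"
  unfolding G_def [abs_def] using that by (intro continuous_intros) fastforce+

lemma continuous_on_k:
  "continuous_on A (k x y p)" if "A \<subseteq> {0<..<1}" "p > 0"
  unfolding k_def [abs_def] using that by (intro continuous_intros) fastforce+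

lemma continuous_on_m:
  "continuous_on A (m x y)" if "A \<subseteq> {..<1/2}"
  unfolding m_def [abs_def] using that by (intro continuous_intros) fastforce+

text \<open>At 0 the value is 0 because \<open>0 powr z = 0\<close>, and the bound by t powr Re x
  gives the same limit; elsewhere \<open>H\<close> is differentiable.\<close>

lemma continuous_on_H:
  assumes "p > 0" "\<epsilon> \<le> 1/4" "Re x > 0" "Re y \<ge> 0"
  shows "continuous_on {0..\<epsilon>} (H x y p)"
  unfolding continuous_on_eq_continuous_within
proof
  fix t assume t: "t \<in> {0..\<epsilon>}"
  show "continuous (at t within {0..\<epsilon>}) (H x y p)"
  proof (cases "t = 0")
    case True
    have "((\<lambda>t. 2 * C * p powr Re s * t powr Re x) \<longlongrightarrow> 2 * C * p powr Re s * 0 powr Re x) (at 0 within {0..\<epsilon>})"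
      using assms by (intro tendsto_intros) (auto simp: eventually_at_filter)
    then have "((\<lambda>t. 2 * C * p powr Re s * t powr Re x) \<longlongrightarrow> 0) (at 0 within {0..\<epsilon>})"
      using assms by simp
    moreover have "\<forall>\<^sub>F t in at 0 within {0..\<epsilon>}. norm (H x y p t) \<le> 2 * C * p powr Re s * t powr Re x"
      using assms by (auto simp: eventually_at_filter intro!: always_eventually norm_H_le)
    ultimately have "(H x y p \<longlongrightarrow> 0) (at 0 within {0..\<epsilon>})"
      by (rule Lim_null_comparison [rotated])
    then show ?thesis using True by (simp add: continuous_within H_def)
  next
    case False
    then have "(H x y p has_vector_derivative (k x y p t * m x y t - of_real p powr s * G x y p t)) (at t)"
      using t assms by (intro H_deriv) auto
    then show ?thesis
      using has_vector_derivative_continuous continuous_at_imp_continuous_at_within by blast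
  qed
qed

text \<open>The first summand comes from the boundary term \<open>H\<close>. The second comes from
  the integral of k * m, where 8 = 2 * 4 combines the bounds on (1 - t) powr (Re y - 1) and on
  \<open>m\<close>, and 1 / r bounds the 1 / Re x from integrating t powr (Re x - 1).\<close>

definition tail_const :: "real \<Rightarrow> real" where
  "tail_const r = 2 * C + 8 * C * (1 + norm s) / r"

lemma tail_const_pos: "r > 0 \<Longrightarrow> tail_const r > 0"
  using C_pos by (simp add: tail_const_def add_pos_nonneg)

text \<open>Integrating the derivative of \<open>H\<close> expresses p powr s times the integral of
  \<open>G\<close> as the integral of k * m minus \<open>H\<close> at \<epsilon>. The product k * m
  is absolutely integrable even where \<open>G\<close> may not be. Both terms are O(p powr Re s), so
  division leaves a bound uniform in p.\<close>

lemma G_tail: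
  assumes r: "r > 0" "Re x \<ge> r" "Re y \<ge> r" and p: "p > 0" and \<epsilon>: "0 \<le> \<epsilon>" "\<epsilon> \<le> 1/4"
  shows "G x y p integrable_on {0..\<epsilon>}"
    and "norm (integral {0..\<epsilon>} (G x y p)) \<le> tail_const r * (1 + norm x + norm y) * \<epsilon> powr Re x"
proof -
  define S where "S = 1 + norm x + norm y"
  define D where "D = C * p powr Re s * (2 * (4 * (1 + norm s) * S))"
  have S: "S \<ge> 1" by (simp add: S_def)
  have D: "D \<ge> 0" using C_pos S by (simp add: D_def)
  have "((\<lambda>t. t powr (Re x - 1)) has_integral (\<epsilon> powr (Re x - 1 + 1) / (Re x - 1 + 1))) {0..\<epsilon>}"
    using r \<epsilon> by (intro has_integral_powr_from_0) auto
  then have g: "((\<lambda>t. D * t powr (Re x - 1)) has_integral (D * (\<epsilon> powr Re x / Re x))) {0..\<epsilon>}"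
    by (intro has_integral_mult_right) simp
  have bd: "norm (k x y p t * m x y t) \<le> D * t powr (Re x - 1)" if t: "t \<in> {0<..<\<epsilon>}" for t
  proof -
    have "norm (k x y p t * m x y t) \<le>
        (C * p powr Re s * (t powr (Re x - 1) * (1 - t) powr (Re y - 1))) * (4 * (1 + norm s) * S)"
      unfolding norm_mult S_def using t p \<epsilon> C_pos
      by (intro mult_mono norm_k_le_powr norm_m_le) auto
    also have "\<dots> \<le> (C * p powr Re s * (t powr (Re x - 1) * 2)) * (4 * (1 + norm s) * S)"
      using t p \<epsilon> r C_pos S by (intro mult_right_mono mult_left_mono powr_minus_one_le_two) auto
    also have "\<dots> = D * t powr (Re x - 1)" by (simp add: D_def)
    finally show ?thesis .
  qed
  have cont: "continuous_on {0<..<\<epsilon>} (\<lambda>t. k x y p t * m x y t)"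
    using p \<epsilon> by (intro continuous_on_mult continuous_on_k continuous_on_m) auto
  define I where "I = integral {0..\<epsilon>} (\<lambda>t. k x y p t * m x y t)"
  have km: "((\<lambda>t. k x y p t * m x y t) has_integral I) {0..\<epsilon>}"
    unfolding I_def using integrable_on_dominated_Ioo [OF cont bd] g by (auto simp: has_integral_integral)
  have I: "norm I \<le> D * (\<epsilon> powr Re x / Re x)"
    unfolding I_def integral_unique [OF g, symmetric]
    by (rule norm_integral_dominated_Ioo [OF cont bd has_integral_integrable [OF g]])
  have H0: "H x y p 0 = 0" by (simp add: H_def)
  have "((\<lambda>t. k x y p t * m x y t - of_real p powr s * G x y p t) has_integral (H x y p \<epsilon> - H x y p 0)) {0..\<epsilon>}"
    using p \<epsilon> r by (intro fundamental_theorem_of_calculus_interior continuous_on_H H_deriv) auto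
  from has_integral_diff [OF km this]
  have "((\<lambda>t. of_real p powr s * G x y p t) has_integral (I - H x y p \<epsilon>)) {0..\<epsilon>}"
    by (simp add: H0)
  from has_integral_mult_right [OF this, of "1 / of_real p powr s"]
  have G: "(G x y p has_integral ((I - H x y p \<epsilon>) / of_real p powr s)) {0..\<epsilon>}"
    using p by simp
  then show "G x y p integrable_on {0..\<epsilon>}" by (rule has_integral_integrable)
  have He: "norm (H x y p \<epsilon>) \<le> 2 * C * p powr Re s * \<epsilon> powr Re x"
    using \<epsilon> p r H0 by (cases "\<epsilon> = 0") (auto intro: norm_H_le)
  have "norm (I - H x y p \<epsilon>) \<le> D * (\<epsilon> powr Re x / Re x) + 2 * C * p powr Re s * \<epsilon> powr Re x"
    using I He norm_triangle_ineq4 by (smt (verit))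
  also have "\<dots> \<le> D * (\<epsilon> powr Re x / r) + 2 * C * p powr Re s * \<epsilon> powr Re x * S"
    using r D S C_pos mult_left_mono [of 1 S "2 * C * p powr Re s * \<epsilon> powr Re x"]
    by (intro add_mono mult_left_mono divide_left_mono) auto
  also have "\<dots> = p powr Re s * (tail_const r * S * \<epsilon> powr Re x)"
    by (simp add: D_def tail_const_def algebra_simps add_divide_distrib)
  finally have "norm (I - H x y p \<epsilon>) / p powr Re s \<le> tail_const r * S * \<epsilon> powr Re x"
    using p by (simp add: divide_le_eq mult_ac)
  then show "norm (integral {0..\<epsilon>} (G x y p)) \<le> tail_const r * (1 + norm x + norm y) * \<epsilon> powr Re x"
    using p unfolding integral_unique [OF G] norm_divide S_def by (simp add: norm_of_real_powr)
qed

text \<open>Since t * (1 - t) is symmetric, the endpoint 1 reduces to the endpoint 0 with x and y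
  exchanged.\<close>

lemma G_reflect: "G y x p (1 - t) = G x y p t"
  by (simp add: G_def mult_ac)

lemma G_tail':
  assumes r: "r > 0" "Re x \<ge> r" "Re y \<ge> r" and p: "p > 0" and \<epsilon>: "0 \<le> \<epsilon>" "\<epsilon> \<le> 1/4"
  shows "G x y p integrable_on {1-\<epsilon>..1}"
    and "norm (integral {1-\<epsilon>..1} (G x y p)) \<le> tail_const r * (1 + norm x + norm y) * \<epsilon> powr Re y"
proof -
  have "(G y x p has_integral integral {0..\<epsilon>} (G y x p)) {0..\<epsilon>}"
    using assms by (intro integrable_integral G_tail)
  from has_integral_reflect_unit [OF this]
  have *: "(G x y p has_integral integral {0..\<epsilon>} (G y x p)) {1-\<epsilon>..1}"
    by (simp add: G_reflect)
  then show "G x y p integrable_on {1-\<epsilon>..1}" by (rule has_integral_integrable)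
  show "norm (integral {1-\<epsilon>..1} (G x y p)) \<le> tail_const r * (1 + norm x + norm y) * \<epsilon> powr Re y"
    using G_tail(2) [of r y x p \<epsilon>] assms unfolding integral_unique [OF *] by (simp add: add_ac)
qed

section \<open>Convergence and cut-off of the beta integral\<close>

lemma G_integrable_mid: "0 < a \<Longrightarrow> b < 1 \<Longrightarrow> G x y p integrable_on {a..b}"
  by (intro integrable_continuous_real continuous_on_G) auto

lemma G_integrable:
  assumes "r > 0" "Re x \<ge> r" "Re y \<ge> r" "p > 0"
  shows "G x y p integrable_on {0..1}"
proof -
  have "G x y p integrable_on {0..1/4}" using assms by (intro G_tail) auto
  moreover have "G x y p integrable_on {1/4..3/4}" by (intro G_integrable_mid) auto
  moreover have "G x y p integrable_on {3/4..1}" using G_tail'(1) [OF assms, of "1/4"] by simp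
  ultimately have "G x y p integrable_on {0..3/4}"
    by (intro Henstock_Kurzweil_Integration.integrable_combine [of 0 "1/4" "3/4"]) auto
  then show ?thesis
    using \<open>G x y p integrable_on {3/4..1}\<close>
    by (intro Henstock_Kurzweil_Integration.integrable_combine [of 0 "3/4" 1]) auto
qed

lemma integral_G_cutoff:
  assumes r: "r > 0" "Re x \<ge> r" "Re y \<ge> r" and p: "p > 0" and \<epsilon>: "0 \<le> \<epsilon>" "\<epsilon> \<le> 1/4"
  shows "integral {\<epsilon>..1-\<epsilon>} (G x y p) =
    integral {0..1} (G x y p) - integral {0..\<epsilon>} (G x y p) - integral {1-\<epsilon>..1} (G x y p)"
proof -
  have i: "G x y p integrable_on {0..1}" using r p by (rule G_integrable)
  have "integral {0..\<epsilon>} (G x y p) + integral {\<epsilon>..1} (G x y p) = integral {0..1} (G x y p)"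
    using \<epsilon> by (intro Henstock_Kurzweil_Integration.integral_combine i) auto
  moreover have "integral {\<epsilon>..1-\<epsilon>} (G x y p) + integral {1-\<epsilon>..1} (G x y p) = integral {\<epsilon>..1} (G x y p)"
    using \<epsilon> by (intro Henstock_Kurzweil_Integration.integral_combine integrable_on_subinterval [OF i]) auto
  ultimately show ?thesis by (simp add: algebra_simps)
qed

lemma integral_G_cutoff_tendsto:
  assumes r: "r > 0" "Re x \<ge> r" "Re y \<ge> r" and p: "p > 0"
  shows "((\<lambda>\<epsilon>. integral {\<epsilon>..1-\<epsilon>} (G x y p)) \<longlongrightarrow> integral {0..1} (G x y p)) (at_right 0)"
proof -
  have ev: "\<forall>\<^sub>F \<epsilon> in at_right 0. \<epsilon> > 0 \<and> \<epsilon> < (1/4::real)"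
    using eventually_at_right [of 0 "1/4::real"] by (auto intro!: exI [of _ "1/4"])
  have z: "((\<lambda>\<epsilon>. tail_const r * (1 + norm x + norm y) * \<epsilon> powr Re z) \<longlongrightarrow> 0) (at_right 0)" if "Re z \<ge> r" for z
  proof -
    have "((\<lambda>\<epsilon>. tail_const r * (1 + norm x + norm y) * \<epsilon> powr Re z) \<longlongrightarrow>
        tail_const r * (1 + norm x + norm y) * 0 powr Re z) (at_right 0)"
      using that r by (intro tendsto_intros) (auto simp: eventually_at_filter)
    then show ?thesis by simp
  qed
  have "((\<lambda>\<epsilon>. integral {0..\<epsilon>} (G x y p)) \<longlongrightarrow> 0) (at_right 0)"
    using ev by (intro Lim_null_comparison [OF _ z [of x]]) (auto elim!: eventually_mono intro!: G_tail r p)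
  moreover have "((\<lambda>\<epsilon>. integral {1-\<epsilon>..1} (G x y p)) \<longlongrightarrow> 0) (at_right 0)"
    using ev by (intro Lim_null_comparison [OF _ z [of y]]) (auto elim!: eventually_mono intro!: G_tail' r p)
  ultimately have "((\<lambda>\<epsilon>. integral {0..1} (G x y p) - integral {0..\<epsilon>} (G x y p) - integral {1-\<epsilon>..1} (G x y p))
     \<longlongrightarrow> integral {0..1} (G x y p) - 0 - 0) (at_right 0)"
    by (intro tendsto_intros)
  then show ?thesis
    using ev by (elim Lim_transform_eventually [rotated] filterlim_cong [THEN iffD1, rotated 3])
      (auto elim!: eventually_mono simp: integral_G_cutoff [OF r p])
qed

text \<open>The integral differs from the one over [1/4, 3/4] by four tails. As D depends only on r
  and P, the bound dominates both the limit in \<epsilon> and the sum over n; \<epsilon> = 0 is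
  included to cover the full integral.\<close>

lemma norm_integral_G_cutoff_le:
  assumes r: "r > 0" and P: "P > 0"
  shows "\<exists>D\<ge>0. \<forall>x y p \<epsilon>. Re x \<ge> r \<longrightarrow> Re y \<ge> r \<longrightarrow> 0 < p \<longrightarrow> p \<le> P \<longrightarrow> 0 \<le> \<epsilon> \<longrightarrow> \<epsilon> \<le> 1/4 \<longrightarrow>
    norm (integral {\<epsilon>..1-\<epsilon>} (G x y p)) \<le> D * (1 + norm x + norm y)"
proof -
  \<comment> \<open>On [1/4, 3/4] one has t * (1 - t) >= 3/16, so \<open>e\<close> is evaluated only
    up to 16/3 * P.\<close>
  have "bounded (e ` {0..16 / 3 * P})"
    by (intro compact_imp_bounded compact_continuous_image continuous_on_subset [OF continuous_e]) auto
  then obtain E where E: "\<forall>u\<in>{0..16 / 3 * P}. norm (e u) \<le> E"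
    by (auto simp: bounded_iff)
  have "norm (e 0) \<le> E" using E P by simp
  then have "E \<ge> 0" using norm_ge_zero order_trans by blast
  define D where "D = 4 * tail_const r + 16 * E"
  have tc: "tail_const r > 0" using r by (rule tail_const_pos)
  have "norm (integral {\<epsilon>..1-\<epsilon>} (G x y p)) \<le> D * (1 + norm x + norm y)"
    if x: "Re x \<ge> r" and y: "Re y \<ge> r" and p: "0 < p" "p \<le> P" and \<epsilon>: "0 \<le> \<epsilon>" "\<epsilon> \<le> 1/4" for x y p \<epsilon>
  proof -
    define S where "S = 1 + norm x + norm y"
    have S: "S \<ge> 1" by (simp add: S_def)
    have t1: "norm (integral {0..\<delta>} (G x y p)) \<le> tail_const r * S"
      if "0 \<le> \<delta>" "\<delta> \<le> 1/4" for \<delta>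
    proof -
      have "norm (integral {0..\<delta>} (G x y p)) \<le> tail_const r * S * \<delta> powr Re x"
        unfolding S_def using that x y p r by (intro G_tail) auto
      also have "\<dots> \<le> tail_const r * S * 1"
        using that x r tc S by (intro mult_left_mono powr_le1) auto
      finally show ?thesis by simp
    qed
    have t2: "norm (integral {1-\<delta>..1} (G x y p)) \<le> tail_const r * S"
      if "0 \<le> \<delta>" "\<delta> \<le> 1/4" for \<delta>
    proof -
      have "norm (integral {1-\<delta>..1} (G x y p)) \<le> tail_const r * S * \<delta> powr Re y"
        unfolding S_def using that x y p r by (intro G_tail') auto
      also have "\<dots> \<le> tail_const r * S * 1"
        using that y r tc S by (intro mult_left_mono powr_le1) auto
      finally show ?thesis by simp
    qed
    have mid: "norm (integral {1/4..3/4} (G x y p)) \<le> 16 * E * (3/4 - 1/4)"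
    proof (rule integral_bound)
      show "continuous_on {1/4..3/4} (G x y p)" by (rule continuous_on_G) auto
      fix t :: real assume t: "t \<in> {1/4..3/4}"
      \<comment> \<open>Exponents at least -1 make this bound independent of x and y; applied to t
        and to 1 - t it gives the factor 16.\<close>
      have q: "u powr (a - 1) \<le> 4" if "1/4 \<le> u" "u \<le> 1" "a \<ge> 0" for u a :: real
      proof -
        have "u powr (a - 1) \<le> u powr (- 1)" using that by (intro powr_mono') auto
        also have "\<dots> = 1 / u" using that by (simp add: powr_minus field_simps)
        also have "\<dots> \<le> 4" using that by (simp add: field_simps)
        finally show ?thesis .
      qed
      \<comment> \<open>Expanding this product gives exactly t * (1 - t) - 3/16 >= 0.\<close>
      have "0 \<le> (t - 1/4) * (3/4 - t)" using t by simp
      then have w: "3 / 16 \<le> t * (1 - t)" by (simp add: field_simps)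
      have "p / (t * (1 - t)) \<le> P / (3 / 16)"
        using w p by (intro frac_le) auto
      moreover have "p / (t * (1 - t)) \<ge> 0" using w p by simp
      ultimately have "norm (e (p / (t * (1 - t)))) \<le> E" using E by simp
      then have "norm (G x y p t) \<le> 4 * 4 * E"
        unfolding G_def norm_mult using t x y r
        by (intro mult_mono) (auto simp: norm_of_real_powr simp del: of_real_diff intro!: q)
      then show "norm (G x y p t) \<le> 16 * E" by simp
    qed simp
    have eq: "integral {\<epsilon>..1-\<epsilon>} (G x y p) - integral {1/4..1-1/4} (G x y p) =
        (integral {0..1/4} (G x y p) - integral {0..\<epsilon>} (G x y p)) +
        (integral {1-1/4..1} (G x y p) - integral {1-\<epsilon>..1} (G x y p))"
      using integral_G_cutoff [OF r x y p(1) \<epsilon>] integral_G_cutoff [OF r x y p(1), of "1/4"] by simp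
    have "norm (integral {\<epsilon>..1-\<epsilon>} (G x y p) - integral {1/4..1-1/4} (G x y p)) \<le>
        (norm (integral {0..1/4} (G x y p)) + norm (integral {0..\<epsilon>} (G x y p))) +
        (norm (integral {1-1/4..1} (G x y p)) + norm (integral {1-\<epsilon>..1} (G x y p)))"
      unfolding eq by (intro norm_triangle_mono norm_triangle_ineq4)
    also have "\<dots> \<le> (tail_const r * S + tail_const r * S) + (tail_const r * S + tail_const r * S)"
      by (intro add_mono t1 t2 \<epsilon>) auto
    finally have "norm (integral {\<epsilon>..1-\<epsilon>} (G x y p) - integral {1/4..3/4} (G x y p)) \<le>
        4 * (tail_const r * S)"
      by (simp add: mult_ac)
    then have "norm (integral {\<epsilon>..1-\<epsilon>} (G x y p)) \<le> 4 * (tail_const r * S) + 8 * E"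
      using mid norm_triangle_sub [of "integral {\<epsilon>..1-\<epsilon>} (G x y p)" "integral {1/4..3/4} (G x y p)"] by simp
    also have "8 * E \<le> 16 * E * S" using S \<open>E \<ge> 0\<close> mult_left_mono [of 1 S "16 * E"] by simp
    finally show ?thesis by (simp add: D_def S_def algebra_simps)
  qed
  moreover have "D \<ge> 0" using tc \<open>E \<ge> 0\<close> by (simp add: D_def)
  ultimately show ?thesis by blast
qed

section \<open>The integral over p for a fixed cut-off in t\<close>

lemma k_nonpos: "p \<le> 0 \<Longrightarrow> t \<in> {0..1} \<Longrightarrow> k x y p t = 0"
  by (simp add: k_def F_nonpos divide_nonpos_nonneg)

text \<open>With w = t * (1 - t), the chain rule gives 1 / w and f (p / w) gives w powr (1 - s);
  together they cancel the factor w powr s contained in \<open>k\<close>.\<close>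

lemma k_deriv:
  assumes t: "0 < t" "t < 1" and p: "p > 0"
  shows "((\<lambda>p. k x y p t) has_vector_derivative of_real p powr (s - 1) * G x y p t) (at p)"
proof -
  define T O' w where "T = complex_of_real t" and "O' = complex_of_real (1 - t)" and "w = t * (1 - t)"
  have w: "w > 0" using t by (simp add: w_def)
  have nz: "T \<noteq> 0" "O' \<noteq> 0"
    using t unfolding T_def O'_def of_real_eq_0_iff by auto
  have "((\<lambda>p. p / w) has_real_derivative (1 / w)) (at p)"
    using w by (auto intro!: derivative_eq_intros)
  then have "(F \<circ> (\<lambda>p. p / w) has_vector_derivative (1 / w) *\<^sub>R f (p / w)) (at p)"
    using w p by (intro vector_diff_chain_at F_deriv) (auto simp: has_real_derivative_iff_has_vector_derivative)
  from has_vector_derivative_mult_right [OF this, of "T powr (x + s - 1) * O' powr (y + s - 1)"]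
  have "((\<lambda>p. k x y p t) has_vector_derivative
      T powr (x + s - 1) * O' powr (y + s - 1) * ((1 / w) *\<^sub>R f (p / w))) (at p)"
    by (simp add: k_def o_def w_def T_def O'_def)
  moreover have "T powr (x + s - 1) * O' powr (y + s - 1) * ((1 / w) *\<^sub>R f (p / w)) =
      of_real p powr (s - 1) * G x y p t"
  proof -
    have f: "f (p / w) = of_real p powr (s - 1) / (T powr (s - 1) * O' powr (s - 1)) * e (p / w)"
      using p t w unfolding f_def of_real_powr_divide [OF p w]
      by (simp add: w_def of_real_powr_mult T_def O'_def del: of_real_mult of_real_diff)
    have T: "T powr (x + s - 1) = T powr (x - 1) * T * T powr (s - 1)"
       "O' powr (y + s - 1) = O' powr (y - 1) * O' * O' powr (s - 1)"
      using nz by (simp_all add: powr_diff powr_add)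
    have sc: "(1 / w) *\<^sub>R f (p / w) = f (p / w) / (T * O')"
      by (simp add: scaleR_conv_of_real w_def T_def O'_def)
    have G: "G x y p t = T powr (x - 1) * O' powr (y - 1) * e (p / w)"
      by (simp add: G_def T_def O'_def w_def)
    have "T powr (s - 1) \<noteq> 0" "O' powr (s - 1) \<noteq> 0" using nz by auto
    then show ?thesis unfolding sc unfolding f T G using nz by (simp add: field_simps)
  qed
  ultimately show ?thesis by simp
qed

text \<open>With the cut-off, t ranges over a compact part of the open unit interval, where the
  p-derivative is jointly continuous, so Leibniz' rule applies.\<close>

lemma integral_k_cutoff_deriv:
  assumes \<epsilon>: "0 < \<epsilon>" and p: "p > 0"
  shows "((\<lambda>p. integral {\<epsilon>..1-\<epsilon>} (k x y p)) has_vector_derivative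
    of_real p powr (s - 1) * integral {\<epsilon>..1-\<epsilon>} (G x y p)) (at p)"
proof -
  have "((\<lambda>p. integral (cbox \<epsilon> (1-\<epsilon>)) (k x y p)) has_vector_derivative
    integral (cbox \<epsilon> (1-\<epsilon>)) (\<lambda>t. of_real p powr (s - 1) * G x y p t)) (at p within {0<..})"
  proof (rule leibniz_rule_vector_derivative)
    fix q t :: real assume "q \<in> {0<..}" "t \<in> cbox \<epsilon> (1 - \<epsilon>)"
    then show "((\<lambda>p. k x y p t) has_vector_derivative of_real q powr (s - 1) * G x y q t) (at q within {0<..})"
      using \<epsilon> by (intro has_vector_derivative_at_within [OF k_deriv]) auto
  next
    fix q :: real assume "q \<in> {0<..}"
    then show "k x y q integrable_on cbox \<epsilon> (1 - \<epsilon>)"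
      using \<epsilon> by (intro integrable_continuous continuous_on_k) auto
  next
    show "continuous_on ({0<..} \<times> cbox \<epsilon> (1 - \<epsilon>)) (\<lambda>(p, t). of_real p powr (s - 1) * G x y p t)"
      unfolding G_def split_beta using \<epsilon>
      by (intro continuous_on_mult continuous_on_of_real_powr continuous_on_e continuous_on_divide
          continuous_on_fst continuous_on_snd continuous_on_diff continuous_on_const continuous_on_id) auto
  qed (use p in auto)
  then show ?thesis using p by (simp add: at_within_open [of p "{0<..}"])
qed

text \<open>For fixed \<epsilon> the last integral is a constant, so this gives decay at p = 0,
  which the derivative formula for p > 0 does not reach.\<close>

lemma norm_integral_k_cutoff_le:
  assumes "0 < \<epsilon>" "0 \<le> p"
  shows "norm (integral {\<epsilon>..1-\<epsilon>} (k x y p)) \<le>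
    C * p powr Re s * integral {\<epsilon>..1-\<epsilon>} (\<lambda>t. t powr (Re x - 1) * (1 - t) powr (Re y - 1))"
proof (cases "p = 0")
  case False
  have "norm (integral {\<epsilon>..1-\<epsilon>} (k x y p)) \<le>
      integral {\<epsilon>..1-\<epsilon>} (\<lambda>t. C * p powr Re s * (t powr (Re x - 1) * (1 - t) powr (Re y - 1)))"
    using assms False
    by (intro integral_norm_bound_integral norm_k_le_powr integrable_continuous_real continuous_on_k)
       (auto intro!: continuous_intros)
  then show ?thesis by simp
next
  case True
  have "integral {\<epsilon>..1-\<epsilon>} (k x y p) = integral {\<epsilon>..1-\<epsilon>} (\<lambda>t. 0)"
    using assms True by (intro Henstock_Kurzweil_Integration.integral_cong k_nonpos) auto
  then show ?thesis using True by simp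
qed

text \<open>The exchange of integrals is read off from a primitive: \<open>K\<close> has the
  integrand as derivative for p > 0 and is continuous at 0 with value 0, so the fundamental theorem
  of calculus applies on [0, P].\<close>

lemma mellin_cutoff:
  assumes \<epsilon>: "0 < \<epsilon>" and P: "P \<ge> 0"
  shows "((\<lambda>p. of_real p powr (s - 1) * integral {\<epsilon>..1-\<epsilon>} (G x y p)) has_integral
    integral {\<epsilon>..1-\<epsilon>} (k x y P)) {0..P}"
proof -
  define K where "K = (\<lambda>p. integral {\<epsilon>..1-\<epsilon>} (k x y p))"
  define B where "B = integral {\<epsilon>..1-\<epsilon>} (\<lambda>t. t powr (Re x - 1) * (1 - t) powr (Re y - 1))"
  have K: "norm (K p) \<le> C * p powr Re s * B" if "p \<ge> 0" for p
    unfolding K_def B_def using \<epsilon> that by (rule norm_integral_k_cutoff_le)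
  have K0: "K 0 = 0" using K [of 0] by simp
  have deriv: "(K has_vector_derivative of_real p powr (s - 1) * integral {\<epsilon>..1-\<epsilon>} (G x y p)) (at p)"
    if "p > 0" for p
    unfolding K_def using \<epsilon> that by (rule integral_k_cutoff_deriv)
  have "continuous_on {0..P} K"
    unfolding continuous_on_eq_continuous_within
  proof
    fix p assume p: "p \<in> {0..P}"
    show "continuous (at p within {0..P}) K"
    proof (cases "p = 0")
      case True
      have "((\<lambda>t. C * t powr Re s * B) \<longlongrightarrow> C * 0 powr Re s * B) (at 0 within {0..P})"
        using Re_s by (intro tendsto_intros) (auto simp: eventually_at_filter)
      then have "((\<lambda>t. C * t powr Re s * B) \<longlongrightarrow> 0) (at 0 within {0..P})" by simp
      moreover have "\<forall>\<^sub>F t in at 0 within {0..P}. norm (K t) \<le> C * t powr Re s * B"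
        by (auto simp: eventually_at_filter intro!: always_eventually K)
      ultimately have "(K \<longlongrightarrow> 0) (at 0 within {0..P})"
        by (rule Lim_null_comparison [rotated])
      then show ?thesis using True by (simp add: continuous_within K0)
    next
      case False
      then show ?thesis
        using p by (intro continuous_at_imp_continuous_at_within [OF has_vector_derivative_continuous [OF deriv]]) auto
    qed
  qed
  then have "((\<lambda>p. of_real p powr (s - 1) * integral {\<epsilon>..1-\<epsilon>} (G x y p)) has_integral K P - K 0) {0..P}"
    using P deriv by (intro fundamental_theorem_of_calculus_interior) auto
  then have "((\<lambda>p. of_real p powr (s - 1) * integral {\<epsilon>..1-\<epsilon>} (G x y p)) has_integral K P) {0..P}"
    by (simp add: K0)
  then show ?thesis unfolding K_def .
qed

section \<open>Removing the cut-off\<close>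

lemma beta_integrable:
  assumes "a > 0" "b > (0::real)"
  shows "(\<lambda>t. t powr (a - 1) * (1 - t) powr (b - 1)) integrable_on {0..1}"
  using has_integral_Beta_real [OF assms] by (rule has_integral_integrable)

text \<open>One integrable majorant serves all p and all x = b + n at once. At the endpoints both
  sides vanish because \<open>0 powr z = 0\<close>.\<close>

lemma k_le_beta:
  assumes "Re x \<ge> r" "Re y \<ge> r" "t \<in> {0..1}"
  shows "norm (k x y p t) \<le> C * (t powr (r + Re s - 1) * (1 - t) powr (r + Re s - 1))"
proof (cases "t = 0 \<or> t = 1")
  case True
  then show ?thesis using C_pos by (auto simp: k_def)
next
  case False
  then have t: "0 < t" "t < 1" using assms by auto
  have "norm (k x y p t) \<le> C * (t powr (Re x + Re s - 1) * (1 - t) powr (Re y + Re s - 1))"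
    using t by (rule norm_k_le)
  also have "\<dots> \<le> C * (t powr (r + Re s - 1) * (1 - t) powr (r + Re s - 1))"
    using t C_pos assms by (intro mult_left_mono mult_mono powr_mono') auto
  finally show ?thesis .
qed

lemma k_integrable:
  assumes "r > 0" "Re x \<ge> r" "Re y \<ge> r"
  shows "k x y p integrable_on {0..1}"
proof (cases "p > 0")
  case True
  show ?thesis
  proof (rule integrable_on_dominated_Ioo)
    show "continuous_on {0<..<1} (k x y p)" using True by (intro continuous_on_k) auto
    show "(\<lambda>t. C * (t powr (r + Re s - 1) * (1 - t) powr (r + Re s - 1))) integrable_on {0..1}"
      using assms Re_s by (intro integrable_on_mult_right beta_integrable) auto
  qed (use assms in \<open>auto intro!: k_le_beta\<close>)
next
  case False
  show ?thesis
    by (rule integrable_eq [OF has_integral_integrable [OF has_integral_0]])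
       (use False in \<open>simp add: k_nonpos\<close>)
qed

lemma norm_integral_k_le:
  assumes "r > 0" "Re x \<ge> r" "Re y \<ge> r"
  shows "norm (integral {0..1} (k x y p)) \<le> C * Beta (r + Re s) (r + Re s)"
proof -
  have "norm (integral {0..1} (k x y p)) \<le>
      integral {0..1} (\<lambda>t. C * (t powr (r + Re s - 1) * (1 - t) powr (r + Re s - 1)))"
    using assms Re_s by (intro integral_norm_bound_integral k_integrable k_le_beta
        integrable_on_mult_right beta_integrable) auto
  also have "\<dots> = C * Beta (r + Re s) (r + Re s)"
    using has_integral_Beta_real [of "r + Re s" "r + Re s"] assms Re_s
    by (simp add: integral_unique)
  finally show ?thesis .
qed

lemma integral_k_cutoff_tendsto:
  assumes r: "r > 0" "Re x \<ge> r" "Re y \<ge> r" and \<delta>: "\<delta> \<longlonglongrightarrow> 0" "\<And>j. \<delta> j > 0"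
  shows "(\<lambda>j::nat. integral {\<delta> j..1-\<delta> j} (k x y p)) \<longlonglongrightarrow> integral {0..1} (k x y p)"
proof -
  define g where "g = (\<lambda>j t. if t \<in> {\<delta> j..1-\<delta> j} then k x y p t else 0)"
  have sub: "{\<delta> j..1-\<delta> j} \<inter> {0..1} = {\<delta> j..1-\<delta> j}" for j
    using \<delta>(2) [of j] by auto
  have i: "k x y p integrable_on {\<delta> j..1-\<delta> j}" for j
    using \<delta>(2) [of j] by (intro integrable_on_subinterval [OF k_integrable [OF r]]) auto
  have "(\<lambda>j. integral {0..1} (g j)) \<longlonglongrightarrow> integral {0..1} (k x y p)"
  proof (rule dominated_convergence)
    show "g j integrable_on {0..1}" for j
      unfolding g_def using i [of j] by (simp only: integrable_restrict_Int sub)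
    show "(\<lambda>t. C * (t powr (r + Re s - 1) * (1 - t) powr (r + Re s - 1))) integrable_on {0..1}"
      using r Re_s by (intro integrable_on_mult_right beta_integrable) auto
    show "norm (g j t) \<le> C * (t powr (r + Re s - 1) * (1 - t) powr (r + Re s - 1))"
      if "t \<in> {0..1}" for j t
      using k_le_beta [OF r(2,3) that] C_pos by (auto simp: g_def)
    show "(\<lambda>j. g j t) \<longlonglongrightarrow> k x y p t" if t: "t \<in> {0..1}" for t
    proof (cases "t = 0 \<or> t = 1")
      \<comment> \<open>At the endpoints \<open>k\<close> is 0, so both branches of \<open>g\<close>
        agree whatever the cut-off.\<close>
      case True
      then have "k x y p t = 0" by (auto simp: k_def)
      then show ?thesis by (simp only: g_def if_cancel tendsto_const)
    next
      case False
      then have "min t (1 - t) > 0" using t by auto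
      then have "\<forall>\<^sub>F j in sequentially. \<delta> j < min t (1 - t)"
        using \<delta>(1) order_tendstoD(2) by blast
      then have "\<forall>\<^sub>F j in sequentially. g j t = k x y p t"
        by eventually_elim (auto simp: g_def)
      then show ?thesis by (rule tendsto_eventually)
    qed
  qed
  moreover have "integral {0..1} (g j) = integral {\<delta> j..1-\<delta> j} (k x y p)" for j
    unfolding g_def integral_restrict_Int sub ..
  ultimately show ?thesis by simp
qed

text \<open>Both sides of the cut-off identity pass to the limit by dominated convergence; for the
  p-integral the majorant is a multiple of p powr (Re s - 1), integrable on [0, P].\<close>

lemma mellin_G:
  assumes r: "r > 0" "Re x \<ge> r" "Re y \<ge> r" and P: "P > 0"
  shows "((\<lambda>p. of_real p powr (s - 1) * integral {0..1} (G x y p)) has_integral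
    integral {0..1} (k x y P)) {0..P}"
proof -
  obtain D where "\<forall>x y p \<epsilon>. Re x \<ge> r \<longrightarrow> Re y \<ge> r \<longrightarrow> 0 < p \<longrightarrow> p \<le> P \<longrightarrow> 0 \<le> \<epsilon> \<longrightarrow> \<epsilon> \<le> 1/4 \<longrightarrow>
    norm (integral {\<epsilon>..1-\<epsilon>} (G x y p)) \<le> D * (1 + norm x + norm y)"
    using norm_integral_G_cutoff_le [OF r(1) P] by blast
  then have D: "norm (integral {\<epsilon>..1-\<epsilon>} (G x y p)) \<le> D * (1 + norm x + norm y)"
    if "0 < p" "p \<le> P" "0 \<le> \<epsilon>" "\<epsilon> \<le> 1/4" for p \<epsilon>
    using that r by blast
  \<comment> \<open>The shift by 4 keeps the cut-off in (0, 1/4] for every j.\<close>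
  define \<delta> where "\<delta> = (\<lambda>j. 1 / (real j + 4))"
  have \<delta>_pos: "\<delta> j > 0" and \<delta>_le: "\<delta> j \<le> 1/4" for j by (auto simp: \<delta>_def field_simps)
  have \<delta>_lim: "\<delta> \<longlonglongrightarrow> 0" unfolding \<delta>_def by real_asymp
  then have \<delta>_lim': "filterlim \<delta> (at_right 0) sequentially"
    using \<delta>_pos by (auto simp: filterlim_at less_imp_neq [symmetric])
  show ?thesis
  proof (rule has_integral_dominated_convergence)
    show "((\<lambda>p. of_real p powr (s - 1) * integral {\<delta> j..1-\<delta> j} (G x y p)) has_integral
        integral {\<delta> j..1-\<delta> j} (k x y P)) {0..P}" for j
      using \<delta>_pos P by (intro mellin_cutoff) auto
    show "(\<lambda>p. D * (1 + norm x + norm y) * p powr (Re s - 1)) integrable_on {0..P}"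
      using Re_s P by (intro integrable_on_mult_right integrable_on_powr_from_0) auto
    show "\<forall>p\<in>{0..P}. norm (of_real p powr (s - 1) * integral {\<delta> j..1-\<delta> j} (G x y p)) \<le>
        D * (1 + norm x + norm y) * p powr (Re s - 1)" for j
    proof
      fix p assume p: "p \<in> {0..P}"
      show "norm (of_real p powr (s - 1) * integral {\<delta> j..1-\<delta> j} (G x y p)) \<le>
          D * (1 + norm x + norm y) * p powr (Re s - 1)"
      proof (cases "p = 0")
        case False
        then have "p powr (Re s - 1) * norm (integral {\<delta> j..1-\<delta> j} (G x y p)) \<le>
            p powr (Re s - 1) * (D * (1 + norm x + norm y))"
          using p \<delta>_pos [of j] \<delta>_le [of j] by (intro mult_left_mono D) auto
        then show ?thesis using p by (simp add: norm_mult norm_of_real_powr mult_ac)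
      qed simp
    qed
    show "\<forall>p\<in>{0..P}. (\<lambda>j. of_real p powr (s - 1) * integral {\<delta> j..1-\<delta> j} (G x y p))
        \<longlonglongrightarrow> of_real p powr (s - 1) * integral {0..1} (G x y p)"
    proof
      fix p assume p: "p \<in> {0..P}"
      show "(\<lambda>j. of_real p powr (s - 1) * integral {\<delta> j..1-\<delta> j} (G x y p))
        \<longlonglongrightarrow> of_real p powr (s - 1) * integral {0..1} (G x y p)"
      proof (cases "p = 0")
        case False
        then show ?thesis
          using p by (intro tendsto_mult tendsto_const
              filterlim_compose [OF integral_G_cutoff_tendsto [OF r] \<delta>_lim']) auto
      qed simp
    qed
    show "(\<lambda>j. integral {\<delta> j..1-\<delta> j} (k x y P)) \<longlonglongrightarrow> integral {0..1} (k x y P)"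
      by (rule integral_k_cutoff_tendsto [OF r \<delta>_lim \<delta>_pos])
  qed
qed

text \<open>Pointwise F (p / w) tends to L inside the unit interval, and the majorant of
  \<open>k\<close> does not depend on p.\<close>

lemma integral_k_tendsto:
  assumes r: "r > 0" "Re x \<ge> r" "Re y \<ge> r"
  shows "((\<lambda>p. integral {0..1} (k x y p)) \<longlongrightarrow> L * Euler_beta (x + s) (y + s)) at_top"
proof (rule tendsto_at_topI_sequentially)
  fix X :: "nat \<Rightarrow> real"
  assume X: "filterlim X at_top sequentially"
  define g where "g = (\<lambda>t. L * (of_real t powr (x + s - 1) * of_real (1 - t) powr (y + s - 1)))"
  have "(\<lambda>n. integral {0..1} (k x y (X n))) \<longlonglongrightarrow> integral {0..1} g"
  proof (rule dominated_convergence)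
    show "k x y (X n) integrable_on {0..1}" for n by (rule k_integrable [OF r])
    show "(\<lambda>t. C * (t powr (r + Re s - 1) * (1 - t) powr (r + Re s - 1))) integrable_on {0..1}"
      using r Re_s by (intro integrable_on_mult_right beta_integrable) auto
    show "norm (k x y (X n) t) \<le> C * (t powr (r + Re s - 1) * (1 - t) powr (r + Re s - 1))"
      if "t \<in> {0..1}" for n t
      by (rule k_le_beta [OF r(2,3) that])
    show "(\<lambda>n. k x y (X n) t) \<longlonglongrightarrow> g t" if t: "t \<in> {0..1}" for t
    proof (cases "t = 0 \<or> t = 1")
      case True
      then show ?thesis by (auto simp: k_def g_def)
    next
      case False
      then have "1 / (t * (1 - t)) > 0" using t by simp
      then have "filterlim (\<lambda>n. 1 / (t * (1 - t)) * X n) at_top sequentially"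
        by (intro filterlim_tendsto_pos_mult_at_top [OF tendsto_const _ X])
      then have "(\<lambda>n. F (X n / (t * (1 - t)))) \<longlonglongrightarrow> L"
        using filterlim_compose [OF F_tendsto] by fastforce
      then have "(\<lambda>n. k x y (X n) t) \<longlonglongrightarrow>
          of_real t powr (x + s - 1) * of_real (1 - t) powr (y + s - 1) * L"
        unfolding k_def by (intro tendsto_intros)
      then show ?thesis by (simp add: g_def mult_ac)
    qed
  qed
  also have "integral {0..1} g = L * Euler_beta (x + s) (y + s)"
    unfolding g_def Euler_beta_def by simp
  finally show "(\<lambda>n. integral {0..1} (k x y (X n))) \<longlonglongrightarrow> L * Euler_beta (x + s) (y + s)" .
qed

text \<open>Partial sums are handled by \<open>mellin_G\<close> and linearity. The bound on the
  integral of \<open>G\<close> grows linearly in n, so the weighted summability of \<open>a\<close>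
  supplies the majorant.\<close>

lemma mellin_sum_upto:
  fixes a :: "nat \<Rightarrow> complex"
  assumes b: "Re b > 0" and y: "Re y > 0" and a: "summable (\<lambda>n. norm (a n) * (1 + real n))"
    and P: "P > 0"
  shows "((\<lambda>p. of_real p powr (s - 1) * (\<Sum>n. integral {0..1} (G (b + of_nat n) y p) * a n)) has_integral
    (\<Sum>n. integral {0..1} (k (b + of_nat n) y P) * a n)) {0..P}"
proof -
  define r where "r = min (Re b) (Re y)"
  have r: "r > 0" "Re (b + of_nat n) \<ge> r" "Re y \<ge> r" for n
    using b y by (auto simp: r_def)
  have norm_a: "summable (\<lambda>n. norm (a n))"
    using a by (rule summable_comparison_test' [where N = 0]) (simp add: algebra_simps)
  obtain D where D0: "D \<ge> 0" and "\<forall>x y p \<epsilon>. Re x \<ge> r \<longrightarrow> Re y \<ge> r \<longrightarrow> 0 < p \<longrightarrow> p \<le> P \<longrightarrow> 0 \<le> \<epsilon> \<longrightarrow> \<epsilon> \<le> 1/4 \<longrightarrow>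
    norm (integral {\<epsilon>..1-\<epsilon>} (G x y p)) \<le> D * (1 + norm x + norm y)"
    using norm_integral_G_cutoff_le [OF r(1) P] by blast
  \<comment> \<open>The instance \<epsilon> = 0 of the cut-off bound.\<close>
  then have "norm (integral {0..1-0} (G (b + of_nat n) y p)) \<le> D * (1 + norm (b + of_nat n) + norm y)"
    if "0 < p" "p \<le> P" for p n
    using that r by (meson order_refl zero_le_divide_1_iff zero_le_numeral)
  then have D: "norm (integral {0..1} (G (b + of_nat n) y p)) \<le> D * (1 + norm (b + of_nat n) + norm y)"
    if "0 < p" "p \<le> P" for p n
    using that by simp
  define M where "M = D * (1 + norm b + norm y)"
  have M: "norm (integral {0..1} (G (b + of_nat n) y p) * a n) \<le> M * (norm (a n) * (1 + real n))"
    if p: "0 < p" "p \<le> P" for p n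
  proof -
    have "1 + norm (b + of_nat n) + norm y \<le> 1 + (norm b + real n) + norm y"
      using norm_triangle_ineq [of b "of_nat n"] by simp
    also have "\<dots> \<le> (1 + norm b + norm y) * (1 + real n)"
      by (simp add: algebra_simps)
    finally have "D * (1 + norm (b + of_nat n) + norm y) \<le> M * (1 + real n)"
      unfolding M_def mult.assoc using D0 by (rule mult_left_mono)
    then have "norm (integral {0..1} (G (b + of_nat n) y p)) \<le> M * (1 + real n)"
      using D [OF p] by (rule order_trans [rotated])
    then show ?thesis
      unfolding norm_mult using mult_right_mono [of _ _ "norm (a n)"] by (fastforce simp: mult_ac)
  qed
  define A where "A = (\<Sum>n. norm (a n) * (1 + real n))"
  have M0: "M \<ge> 0" using D0 by (simp add: M_def)
  show ?thesis
  proof (rule has_integral_dominated_convergence)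
    show "((\<lambda>p. of_real p powr (s - 1) * (\<Sum>n<N. integral {0..1} (G (b + of_nat n) y p) * a n)) has_integral
      (\<Sum>n<N. integral {0..1} (k (b + of_nat n) y P) * a n)) {0..P}" for N
      unfolding sum_distrib_left mult.assoc [symmetric]
      by (intro has_integral_sum has_integral_mult_left mellin_G [OF r P]) auto
    show "(\<lambda>p. M * A * p powr (Re s - 1)) integrable_on {0..P}"
      using Re_s P by (intro integrable_on_mult_right integrable_on_powr_from_0) auto
    show "\<forall>p\<in>{0..P}. norm (of_real p powr (s - 1) * (\<Sum>n<N. integral {0..1} (G (b + of_nat n) y p) * a n))
        \<le> M * A * p powr (Re s - 1)" for N
    proof
      fix p assume p: "p \<in> {0..P}"
      show "norm (of_real p powr (s - 1) * (\<Sum>n<N. integral {0..1} (G (b + of_nat n) y p) * a n))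
        \<le> M * A * p powr (Re s - 1)"
      proof (cases "p = 0")
        case False
        have "norm (\<Sum>n<N. integral {0..1} (G (b + of_nat n) y p) * a n) \<le> (\<Sum>n<N. M * (norm (a n) * (1 + real n)))"
          using p False by (intro sum_norm_le M) auto
        also have "\<dots> \<le> M * A"
          unfolding sum_distrib_left [symmetric] A_def
          by (intro mult_left_mono sum_le_suminf a M0) auto
        finally have "p powr (Re s - 1) * norm (\<Sum>n<N. integral {0..1} (G (b + of_nat n) y p) * a n)
            \<le> p powr (Re s - 1) * (M * A)"
          by (rule mult_left_mono) simp
        then show ?thesis using p by (simp add: norm_mult norm_of_real_powr mult_ac)
      qed simp
    qed
    show "\<forall>p\<in>{0..P}. (\<lambda>N. of_real p powr (s - 1) * (\<Sum>n<N. integral {0..1} (G (b + of_nat n) y p) * a n))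
        \<longlonglongrightarrow> of_real p powr (s - 1) * (\<Sum>n. integral {0..1} (G (b + of_nat n) y p) * a n)"
    proof
      fix p assume p: "p \<in> {0..P}"
      show "(\<lambda>N. of_real p powr (s - 1) * (\<Sum>n<N. integral {0..1} (G (b + of_nat n) y p) * a n))
        \<longlonglongrightarrow> of_real p powr (s - 1) * (\<Sum>n. integral {0..1} (G (b + of_nat n) y p) * a n)"
      proof (cases "p = 0")
        case False
        have "summable (\<lambda>n. integral {0..1} (G (b + of_nat n) y p) * a n)"
          using p False by (intro summable_comparison_test' [OF summable_mult [OF a, of M], where N = 0] M) auto
        then show ?thesis
          by (intro tendsto_mult tendsto_const summable_LIMSEQ)
      qed simp
    qed
    \<comment> \<open>For \<open>k\<close> the bound is independent of n, so the unweighted series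
      is the majorant.\<close>
    have "summable (\<lambda>n. integral {0..1} (k (b + of_nat n) y P) * a n)"
      by (rule summable_comparison_test' [OF summable_mult [OF norm_a, of "C * Beta (r + Re s) (r + Re s)"], where N = 0])
         (auto simp: norm_mult intro!: mult_right_mono norm_integral_k_le r)
    then show "(\<lambda>N. \<Sum>n<N. integral {0..1} (k (b + of_nat n) y P) * a n)
        \<longlonglongrightarrow> (\<Sum>n. integral {0..1} (k (b + of_nat n) y P) * a n)"
      by (rule summable_LIMSEQ)
  qed
qed

text \<open>The terms in \<open>k\<close> are dominated uniformly in P, so Tannery's theorem gives
  the limit of their sum as P grows; Hake's theorem turns it into the integral over the
  half-line.\<close>

lemma mellin_sum:
  fixes a :: "nat \<Rightarrow> complex"
  assumes b: "Re b > 0" and y: "Re y > 0" and a: "summable (\<lambda>n. norm (a n) * (1 + real n))"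
  shows "((\<lambda>p. of_real p powr (s - 1) * (\<Sum>n. integral {0..1} (G (b + of_nat n) y p) * a n)) has_integral
    (\<Sum>n. L * Euler_beta (b + of_nat n + s) (y + s) * a n)) {0..}"
proof (rule has_integral_at_topI)
  fix P :: real assume "P \<ge> 0"
  show "((\<lambda>p. of_real p powr (s - 1) * (\<Sum>n. integral {0..1} (G (b + of_nat n) y p) * a n)) has_integral
    (\<Sum>n. integral {0..1} (k (b + of_nat n) y P) * a n)) {0..P}"
  proof (cases "P = 0")
    case True
    have "integral {0..1} (k (b + of_nat n) y 0) = integral {0..1} (\<lambda>t::real. 0)" for n
      by (intro Henstock_Kurzweil_Integration.integral_cong k_nonpos) auto
    then show ?thesis using True by (simp add: has_integral_refl)
  next
    case False
    then show ?thesis using \<open>P \<ge> 0\<close> assms by (intro mellin_sum_upto) auto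
  qed
next
  define r where "r = min (Re b) (Re y)"
  have r: "r > 0" "Re (b + of_nat n) \<ge> r" "Re y \<ge> r" for n
    using b y by (auto simp: r_def)
  have norm_a: "summable (\<lambda>n. norm (a n))"
    using a by (rule summable_comparison_test' [where N = 0]) (simp add: algebra_simps)
  have "((\<lambda>P. integral {0..1} (k (b + of_nat n) y P) * a n) \<longlongrightarrow>
      L * Euler_beta (b + of_nat n + s) (y + s) * a n) at_top" for n
    by (intro tendsto_mult tendsto_const integral_k_tendsto [OF r])
  moreover have "eventually (\<lambda>(n, P). norm (integral {0..1} (k (b + of_nat n) y P) * a n) \<le>
      C * Beta (r + Re s) (r + Re s) * norm (a n)) (at_top \<times>\<^sub>F at_top)"
    by (auto intro!: always_eventually mult_right_mono norm_integral_k_le r simp: norm_mult)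
  ultimately show "((\<lambda>P. \<Sum>n. integral {0..1} (k (b + of_nat n) y P) * a n) \<longlongrightarrow>
      (\<Sum>n. L * Euler_beta (b + of_nat n + s) (y + s) * a n)) at_top"
    using tannerys_theorem [OF _ _ summable_mult [OF norm_a]] by (fastforce simp del: suminf_mult2)
qed

end

section \<open>Euler's beta integral and the confluent hypergeometric series\<close>

lemma Euler_beta_integrable:
  assumes "Re x > 0" "Re y > 0"
  shows "(\<lambda>t. complex_of_real t powr (x - 1) * of_real (1 - t) powr (y - 1)) integrable_on {0..1}"
proof (rule integrable_on_dominated_Ioo)
  show "continuous_on {0<..<1} (\<lambda>t. complex_of_real t powr (x - 1) * of_real (1 - t) powr (y - 1))"
    by (intro continuous_on_mult continuous_on_of_real_powr continuous_on_diff continuous_on_const continuous_on_id) auto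
  show "(\<lambda>t. t powr (Re x - 1) * (1 - t) powr (Re y - 1)) integrable_on {0..1}"
    using has_integral_Beta_real [OF assms] by (rule has_integral_integrable)
qed (simp add: norm_mult norm_of_real_powr del: of_real_diff)

text \<open>The function t powr x * (1 - t) powr y vanishes at both endpoints, so its derivative, a
  combination of the two beta integrands, integrates to 0.\<close>

lemma Euler_beta_plus1:
  assumes "Re x > 0" "Re y > 0"
  shows "(x + y) * Euler_beta (x + 1) y = x * Euler_beta x y"
proof -
  define h where "h = (\<lambda>t. complex_of_real t powr x * of_real (1 - t) powr y)"
  \<comment> \<open>The exponent \<open>x + 1 - 1\<close> is left as it stands to match the
    integrand of \<open>Euler_beta (x + 1) y\<close>.\<close>
  define h' where "h' = (\<lambda>t. x * (complex_of_real t powr (x - 1) * of_real (1 - t) powr (y - 1))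
    - (x + y) * (complex_of_real t powr (x + 1 - 1) * of_real (1 - t) powr (y - 1)))"
  have "(h' has_integral h 1 - h 0) {0..1}"
  proof (rule fundamental_theorem_of_calculus_interior)
    show "continuous_on {0..1} h"
      unfolding h_def using assms by (intro continuous_intros) auto
    fix t :: real assume t: "t \<in> {0<..<1}"
    define T where "T = complex_of_real t"
    have nn: "T \<notin> \<real>\<^sub>\<le>\<^sub>0" "1 - T \<notin> \<real>\<^sub>\<le>\<^sub>0" using t by (auto simp: T_def complex_nonpos_Reals_iff)
    then have nz: "T \<noteq> 0" "1 - T \<noteq> 0" by auto
    have "((\<lambda>z. z powr x * (1 - z) powr y) has_field_derivative
        (x * T powr (x - 1) * (1 - T) powr y - y * (1 - T) powr (y - 1) * T powr x)) (at T)"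
      by (rule derivative_eq_intros refl nn | simp add: nn)+
    also have "x * T powr (x - 1) * (1 - T) powr y - y * (1 - T) powr (y - 1) * T powr x = h' t"
    proof -
      have h't: "h' t = x * (T powr (x - 1) * (1 - T) powr (y - 1)) - (x + y) * (T powr x * (1 - T) powr (y - 1))"
        by (simp add: h'_def T_def)
      have T: "T powr x = T * T powr (x - 1)" "(1 - T) powr y = (1 - T) * (1 - T) powr (y - 1)"
        using nz by (simp_all add: powr_diff)
      show ?thesis unfolding h't T by (simp add: algebra_simps)
    qed
    finally show "(h has_vector_derivative h' t) (at t)"
      unfolding h_def T_def using has_vector_derivative_real_field by fastforce
  qed simp
  then have "integral {0..1} h' = 0"
    using assms by (simp add: h_def integral_unique)
  moreover have "integral {0..1} h' = x * Euler_beta x y - (x + y) * Euler_beta (x + 1) y"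
    unfolding h'_def Euler_beta_def using assms
    by (subst integral_diff [OF integrable_on_mult_right integrable_on_mult_right,
          OF Euler_beta_integrable Euler_beta_integrable]) (auto simp del: of_real_diff)
  ultimately show ?thesis by simp
qed

text \<open>Iterating the recurrence produces the coefficients of the confluent hypergeometric
  series.\<close>

lemma Euler_beta_plus_of_nat:
  assumes "Re x > 0" "Re y > 0"
  shows "Euler_beta (x + of_nat n) y = pochhammer x n / pochhammer (x + y) n * Euler_beta x y"
proof (induction n)
  case (Suc n)
  have "x + of_nat n + y \<noteq> 0" using assms by (auto simp: complex_eq_iff)
  then have "Euler_beta (x + of_nat n + 1) y = (x + of_nat n) / (x + of_nat n + y) * Euler_beta (x + of_nat n) y"
    using Euler_beta_plus1 [of "x + of_nat n" y] assms by (simp add: field_simps)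
  then show ?case
    by (simp add: Suc pochhammer_Suc add_ac mult_ac)
qed simp

text \<open>Each factor equals 1 + (x - w) / (w + n), and |w + n| >= Re w.\<close>

lemma norm_pochhammer_ratio_le:
  fixes x w :: complex
  assumes "Re w > 0"
  shows "norm (pochhammer x n / pochhammer w n) \<le> (1 + norm (x - w) / Re w) ^ n"
proof (induction n)
  case (Suc n)
  have w: "norm (w + of_nat n) \<ge> Re w"
    using complex_Re_le_cmod [of "w + of_nat n"] by simp
  then have nz: "w + of_nat n \<noteq> 0" using assms by auto
  then have "(x + of_nat n) / (w + of_nat n) = 1 + (x - w) / (w + of_nat n)"
    by (simp add: field_simps)
  also have "norm \<dots> \<le> 1 + norm (x - w) / norm (w + of_nat n)"
    by (metis norm_divide norm_one norm_triangle_ineq)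
  also have "\<dots> \<le> 1 + norm (x - w) / Re w"
    using w assms by (intro add_left_mono divide_left_mono mult_pos_pos) (use nz in auto)
  finally have "norm ((x + of_nat n) / (w + of_nat n)) \<le> 1 + norm (x - w) / Re w" .
  moreover have "pochhammer x (Suc n) / pochhammer w (Suc n) =
      pochhammer x n / pochhammer w n * ((x + of_nat n) / (w + of_nat n))"
    by (simp add: pochhammer_Suc)
  ultimately show ?case
    using Suc assms by (simp only: norm_mult power_Suc2) (intro mult_mono, auto)
qed simp

lemma confluent_hypergeometric_summable:
  assumes "Re w > 0"
  shows "summable (\<lambda>n. pochhammer x n / pochhammer w n * (z ^ n / fact n))"
proof (rule summable_comparison_test' [where N = 0])
  define M where "M = 1 + norm (x - w) / Re w"
  show "summable (\<lambda>n. inverse (fact n) * (M * norm z) ^ n)"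
    by (rule summable_exp)
  fix n :: nat
  have "norm (pochhammer x n / pochhammer w n * (z ^ n / fact n)) \<le> M ^ n * norm (z ^ n / fact n)"
    unfolding norm_mult M_def using assms by (intro mult_right_mono norm_pochhammer_ratio_le) auto
  also have "\<dots> = inverse (fact n) * (M * norm z) ^ n"
    by (simp add: norm_divide norm_power power_mult_distrib field_simps)
  finally show "norm (pochhammer x n / pochhammer w n * (z ^ n / fact n)) \<le> inverse (fact n) * (M * norm z) ^ n" .
qed

text \<open>The weight is absorbed by 1 + n <= 2^n, leaving the exponential series at 2 |z|.\<close>

lemma summable_exp_weighted:
  fixes z w :: complex
  shows "summable (\<lambda>n. norm (w * (z ^ n / fact n)) * (1 + real n))"
proof (rule summable_comparison_test' [where N = 0])
  show "summable (\<lambda>n. norm w * (inverse (fact n) * (2 * norm z) ^ n))"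
    using summable_exp [of "2 * norm z"] by (intro summable_mult) 
  fix n :: nat
  have "1 + real n \<le> 2 ^ n"
    using less_exp [of n] by (metis Suc_leI of_nat_Suc of_nat_le_iff of_nat_numeral of_nat_power)
  then have "norm (w * (z ^ n / fact n)) * (1 + real n) \<le> norm (w * (z ^ n / fact n)) * 2 ^ n"
    by (intro mult_left_mono) auto
  also have "\<dots> = norm w * (inverse (fact n) * (2 * norm z) ^ n)"
    by (simp add: norm_mult norm_divide norm_power power_mult_distrib field_simps)
  finally show "norm (norm (w * (z ^ n / fact n)) * (1 + real n)) \<le> norm w * (inverse (fact n) * (2 * norm z) ^ n)"
    by simp
qed

text \<open>As \<open>integral\<close> has a default value on non-integrable functions, convergence
  is stated explicitly: assumed for \<open>MLGamma\<close>, proved for the Mellin transform.\<close>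

theorem theorem3p7:
  fixes \<alpha> \<beta> \<gamma> b c z s :: complex
  assumes "Re \<alpha> > 0" and "Re c > Re b" and "Re b > 0" and "Re s > 0"
    and MLGamma_converges: "MLGamma_integrand \<alpha> \<beta> \<gamma> s integrable_on {0..}"
  shows "mellin_integrand (\<lambda>p. MLPhi \<alpha> \<beta> \<gamma> p b c z) s integrable_on {0..} \<and>
         mellin_transform (\<lambda>p. MLPhi \<alpha> \<beta> \<gamma> p b c z) s =
           MLGamma \<alpha> \<beta> \<gamma> s * Euler_beta (b + s) (c + s - b) / Euler_beta b (c - b) *
           confluent_hypergeometric (b + s) (c + 2 * s) z"
proof -
  define e where "e = (\<lambda>u. mittag_leffler3 \<alpha> \<beta> \<gamma> (- of_real u))"
  have "continuous_on UNIV e"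
    unfolding e_def
    by (rule continuous_on_compose2 [OF continuous_on_mittag_leffler3 [of \<alpha> UNIV]])
       (use assms in \<open>auto intro!: continuous_intros\<close>)
  then interpret mellin_kernel s e
    using assms by unfold_locales (auto simp: e_def MLGamma_integrand_def [abs_def])
  define B where "B = Euler_beta b (c - b)"
  define a where "a = (\<lambda>n. 1 / B * (z ^ n / fact n))"
  have "summable (\<lambda>n. norm (a n) * (1 + real n))"
    unfolding a_def by (rule summable_exp_weighted)
  then have int: "((\<lambda>p. of_real p powr (s - 1) * (\<Sum>n. integral {0..1} (G (b + of_nat n) (c - b) p) * a n)) has_integral
    (\<Sum>n. L * Euler_beta (b + of_nat n + s) (c - b + s) * a n)) {0..}"
    using assms by (intro mellin_sum) auto
  have "of_real p powr (s - 1) * (\<Sum>n. integral {0..1} (G (b + of_nat n) (c - b) p) * a n) =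
      mellin_integrand (\<lambda>p. MLPhi \<alpha> \<beta> \<gamma> p b c z) s p" for p
    unfolding G_def [abs_def] unfolding e_def
    by (simp add: mellin_integrand_def MLPhi_def MLBeta_def a_def B_def)
  moreover have "(\<Sum>n. L * Euler_beta (b + of_nat n + s) (c - b + s) * a n) =
      MLGamma \<alpha> \<beta> \<gamma> s * Euler_beta (b + s) (c + s - b) / Euler_beta b (c - b) *
           confluent_hypergeometric (b + s) (c + 2 * s) z"
  proof -
    have L: "L = MLGamma \<alpha> \<beta> \<gamma> s"
      unfolding L_def f_def [abs_def] unfolding e_def
      by (simp add: MLGamma_def MLGamma_integrand_def [abs_def])
    \<comment> \<open>The parameter c + 2 * s arises as the sum of the beta arguments b + s and c -
      b + s.\<close>
    have *: "L * Euler_beta (b + of_nat n + s) (c - b + s) * a n =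
       L * Euler_beta (b + s) (c + s - b) / B *
        (pochhammer (b + s) n / pochhammer (c + 2 * s) n * (z ^ n / fact n))" for n
      using Euler_beta_plus_of_nat [of "b + s" "c - b + s" n] assms
      by (simp add: a_def algebra_simps)
    show ?thesis
      unfolding * confluent_hypergeometric_def L [symmetric] B_def [symmetric]
      using assms by (intro suminf_mult confluent_hypergeometric_summable) auto
  qed
  ultimately have "(mellin_integrand (\<lambda>p. MLPhi \<alpha> \<beta> \<gamma> p b c z) s has_integral
      MLGamma \<alpha> \<beta> \<gamma> s * Euler_beta (b + s) (c + s - b) / Euler_beta b (c - b) *
           confluent_hypergeometric (b + s) (c + 2 * s) z) {0..}"
    using int by simp
  then show ?thesis
    unfolding mellin_transform_def by (auto simp: integral_unique has_integral_integrable)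
qed

end
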